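(* Let $R$ be a commutative ring with identity which is locally stable. Then $R$ is an elementary divisor ring if and only if $R$ is a Bézout ring.
   Context: All rings are commutative with identity; $U(R)$ is the unit group of $R$. For $a\in R$ put $S_a=\{b\in R \mid aR+bR=R\}$, a multiplicatively closed set, and $R_a=S_a^{-1}R$ (the localization of $R$ at $S_a$; this is not the localization at the powers of $a$). A ring $R$ has stable range 1 if whenever $cR+dR=R$ with $c,d\in R$, there is $y\in R$ with $c+dy\in U(R)$. A ring $R$ is locally stable if whenever $cR+dR=R$ with $c,d\in R$, there is $y\in R$ such that $R_{c+dy}$ has stable range 1. A (not necessarily square) matrix $A$ over $R$ admits a diagonal reduction if there are invertible matrices $P,Q$ such that $PAQ=(\varepsilon_{ij})$ is a diagonal matrix with $\varepsilon_{ii}$ dividing $\varepsilon_{(i+1)(i+1)}$ for each $i$. $R$ is an elementary divisor ring if every matrix over $R$ admits a diagonal reduction. $R$ is a Bézout ring if every finitely generated ideal is principal. *)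

theory Defs
  imports "HOL-Algebra.Ideal" "HOL-Algebra.Divisibility" "Jordan_Normal_Form.Matrix"
begin

section \<open>Localization\<close>

text \<open>
  Fractions \<open>r/s\<close> are equivalence classes of pairs \<open>(r, s)\<close>. The factor \<open>t\<close> is needed because
  \<open>S\<close> may contain zero divisors, and even \<open>\<zero>\<close>; in the latter case the localization is the
  zero ring.
\<close>

definition frac_rel :: "('a, 'm) ring_scheme \<Rightarrow> 'a set \<Rightarrow> (('a \<times> 'a) \<times> ('a \<times> 'a)) set" where
  "frac_rel R S = {((r, s), (r', s')).
     r \<in> carrier R \<and> s \<in> S \<and> r' \<in> carrier R \<and> s' \<in> S \<and>
     (\<exists>t\<in>S. t \<otimes>\<^bsub>R\<^esub> (r \<otimes>\<^bsub>R\<^esub> s') = t \<otimes>\<^bsub>R\<^esub> (r' \<otimes>\<^bsub>R\<^esub> s))}"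

definition fraction :: "('a, 'm) ring_scheme \<Rightarrow> 'a set \<Rightarrow> 'a \<times> 'a \<Rightarrow> ('a \<times> 'a) set" where
  "fraction R S p = frac_rel R S `` {p}"

definition localization :: "('a, 'm) ring_scheme \<Rightarrow> 'a set \<Rightarrow> ('a \<times> 'a) set ring" where
  "localization R S =
    \<lparr>carrier = (carrier R \<times> S) // frac_rel R S,
     monoid.mult = (\<lambda>A B. \<Union>(r, s)\<in>A. \<Union>(r', s')\<in>B.
        fraction R S (r \<otimes>\<^bsub>R\<^esub> r', s \<otimes>\<^bsub>R\<^esub> s')),
     one = fraction R S (\<one>\<^bsub>R\<^esub>, \<one>\<^bsub>R\<^esub>),
     zero = fraction R S (\<zero>\<^bsub>R\<^esub>, \<one>\<^bsub>R\<^esub>),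
     add = (\<lambda>A B. \<Union>(r, s)\<in>A. \<Union>(r', s')\<in>B.
        fraction R S ((r \<otimes>\<^bsub>R\<^esub> s') \<oplus>\<^bsub>R\<^esub> (r' \<otimes>\<^bsub>R\<^esub> s), s \<otimes>\<^bsub>R\<^esub> s'))\<rparr>"

context
  fixes R (structure) and S
  assumes R: "cring R" and S: "submonoid S R"
begin

interpretation cring R by (rule R)

private lemma S_carrier: "s \<in> S \<Longrightarrow> s \<in> carrier R"
  using submonoid.subset[OF S] by auto

private lemma S_mult: "s \<in> S \<Longrightarrow> t \<in> S \<Longrightarrow> s \<otimes> t \<in> S"
  by (rule submonoid.m_closed[OF S])

private lemma S_one: "\<one> \<in> S"
  by (rule submonoid.one_closed[OF S])

lemma equiv_frac_rel: "equiv (carrier R \<times> S) (frac_rel R S)"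
proof (rule equivI)
  show "refl_on (carrier R \<times> S) (frac_rel R S)"
    using S_one by (auto simp: refl_on_def frac_rel_def)
  show "frac_rel R S \<subseteq> (carrier R \<times> S) \<times> (carrier R \<times> S)"
    by (auto simp: frac_rel_def)
  show "sym (frac_rel R S)"
    by (auto simp: sym_def frac_rel_def) metis
  show "trans (frac_rel R S)"
  proof (rule transI)
    fix p q u assume "(p, q) \<in> frac_rel R S" "(q, u) \<in> frac_rel R S"
    then obtain a b c d e f t v where p: "p = (a, b)" and q: "q = (c, d)" and u: "u = (e, f)"
      and mem: "a \<in> carrier R" "b \<in> S" "c \<in> carrier R" "d \<in> S" "e \<in> carrier R" "f \<in> S"
        "t \<in> S" "v \<in> S"
      and 1: "t \<otimes> (a \<otimes> d) = t \<otimes> (c \<otimes> b)" and 2: "v \<otimes> (c \<otimes> f) = v \<otimes> (e \<otimes> d)"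
      by (cases p, cases q, cases u) (auto simp: frac_rel_def)
    note carr = mem S_carrier[OF mem(2)] S_carrier[OF mem(4)] S_carrier[OF mem(6)]
      S_carrier[OF mem(7)] S_carrier[OF mem(8)]
    have "(t \<otimes> v \<otimes> d) \<otimes> (a \<otimes> f) = (t \<otimes> (a \<otimes> d)) \<otimes> (v \<otimes> f)"
      using carr by (simp add: m_ac)
    also have "\<dots> = (v \<otimes> (c \<otimes> f)) \<otimes> (t \<otimes> b)"
      unfolding 1 using carr by (simp add: m_ac)
    also have "\<dots> = (t \<otimes> v \<otimes> d) \<otimes> (e \<otimes> b)"
      unfolding 2 using carr by (simp add: m_ac)
    finally show "(p, u) \<in> frac_rel R S"
      using mem S_mult by (auto simp: frac_rel_def p u intro!: bexI[of _ "t \<otimes> v \<otimes> d"])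
  qed
qed

lemma fraction_eq_iff:
  assumes "r \<in> carrier R" "s \<in> S" "r' \<in> carrier R" "s' \<in> S"
  shows "fraction R S (r, s) = fraction R S (r', s') \<longleftrightarrow>
    (\<exists>t\<in>S. t \<otimes> (r \<otimes> s') = t \<otimes> (r' \<otimes> s))"
  using assms eq_equiv_class_iff[OF equiv_frac_rel, of "(r, s)" "(r', s')"]
  by (auto simp: fraction_def frac_rel_def)

private lemma fraction_eqI:
  assumes "r \<in> carrier R" "s \<in> S" "r' \<in> carrier R" "s' \<in> S" "r \<otimes> s' = r' \<otimes> s"
  shows "fraction R S (r, s) = fraction R S (r', s')"
  using assms S_one by (subst fraction_eq_iff) auto

lemma carrier_localization:
  "carrier (localization R S) = {fraction R S (r, s) | r s. r \<in> carrier R \<and> s \<in> S}"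
  by (auto simp: localization_def quotient_def fraction_def)

lemma mult_localization:
  assumes "r \<in> carrier R" "s \<in> S" "r' \<in> carrier R" "s' \<in> S"
  shows "fraction R S (r, s) \<otimes>\<^bsub>localization R S\<^esub> fraction R S (r', s') = fraction R S (r \<otimes> r', s \<otimes> s')"
proof -
  have "congruent2 (frac_rel R S) (frac_rel R S)
      (\<lambda>p q. fraction R S (fst p \<otimes> fst q, snd p \<otimes> snd q))"
  proof (rule congruent2_commuteI[OF equiv_frac_rel])
    fix p q assume "p \<in> carrier R \<times> S" "q \<in> carrier R \<times> S"
    then show "fraction R S (fst p \<otimes> fst q, snd p \<otimes> snd q) = fraction R S (fst q \<otimes> fst p, snd q \<otimes> snd p)"
      using S_carrier by (auto simp: m_comm)
  next
    fix p q u assume u: "u \<in> carrier R \<times> S" and "(p, q) \<in> frac_rel R S"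
    then obtain a b c d t where p: "p = (a, b)" and q: "q = (c, d)"
      and mem: "a \<in> carrier R" "b \<in> S" "c \<in> carrier R" "d \<in> S" "t \<in> S"
      and 1: "t \<otimes> (a \<otimes> d) = t \<otimes> (c \<otimes> b)"
      by (cases p, cases q) (auto simp: frac_rel_def)
    obtain e f where u': "u = (e, f)" "e \<in> carrier R" "f \<in> S" using u by auto
    note carr = mem u' S_carrier[OF mem(2)] S_carrier[OF mem(4)] S_carrier[OF mem(5)]
      S_carrier[OF u'(3)]
    have "t \<otimes> ((e \<otimes> a) \<otimes> (f \<otimes> d)) = (t \<otimes> (a \<otimes> d)) \<otimes> (e \<otimes> f)"
      using carr by (simp add: m_ac)
    also have "\<dots> = t \<otimes> ((e \<otimes> c) \<otimes> (f \<otimes> b))"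
      unfolding 1 using carr by (simp add: m_ac)
    finally show "fraction R S (fst u \<otimes> fst p, snd u \<otimes> snd p) = fraction R S (fst u \<otimes> fst q, snd u \<otimes> snd q)"
      using mem u' S_mult by (auto simp: p q fraction_eq_iff)
  qed
  from UN_equiv_class2[OF equiv_frac_rel equiv_frac_rel this, of "(r, s)" "(r', s')"] assms
  show ?thesis by (simp add: localization_def fraction_def case_prod_unfold)
qed

lemma add_localization:
  assumes "r \<in> carrier R" "s \<in> S" "r' \<in> carrier R" "s' \<in> S"
  shows "fraction R S (r, s) \<oplus>\<^bsub>localization R S\<^esub> fraction R S (r', s') =
    fraction R S (r \<otimes> s' \<oplus> r' \<otimes> s, s \<otimes> s')"
proof -
  have "congruent2 (frac_rel R S) (frac_rel R S)
      (\<lambda>p q. fraction R S (fst p \<otimes> snd q \<oplus> fst q \<otimes> snd p, snd p \<otimes> snd q))"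
  proof (rule congruent2_commuteI[OF equiv_frac_rel])
    fix p q assume "p \<in> carrier R \<times> S" "q \<in> carrier R \<times> S"
    then show "fraction R S (fst p \<otimes> snd q \<oplus> fst q \<otimes> snd p, snd p \<otimes> snd q) =
        fraction R S (fst q \<otimes> snd p \<oplus> fst p \<otimes> snd q, snd q \<otimes> snd p)"
      using S_carrier by (auto simp: m_comm a_comm)
  next
    fix p q u assume u: "u \<in> carrier R \<times> S" and "(p, q) \<in> frac_rel R S"
    then obtain a b c d t where p: "p = (a, b)" and q: "q = (c, d)"
      and mem: "a \<in> carrier R" "b \<in> S" "c \<in> carrier R" "d \<in> S" "t \<in> S"
      and 1: "t \<otimes> (a \<otimes> d) = t \<otimes> (c \<otimes> b)"
      by (cases p, cases q) (auto simp: frac_rel_def)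
    obtain e f where u': "u = (e, f)" "e \<in> carrier R" "f \<in> S" using u by auto
    note carr = mem u' S_carrier[OF mem(2)] S_carrier[OF mem(4)] S_carrier[OF mem(5)]
      S_carrier[OF u'(3)]
    have "t \<otimes> ((e \<otimes> b \<oplus> a \<otimes> f) \<otimes> (f \<otimes> d)) =
        t \<otimes> (e \<otimes> b \<otimes> (f \<otimes> d)) \<oplus> (t \<otimes> (a \<otimes> d)) \<otimes> (f \<otimes> f)"
      using carr by (simp add: m_ac l_distr r_distr)
    also have "\<dots> = t \<otimes> ((e \<otimes> d \<oplus> c \<otimes> f) \<otimes> (f \<otimes> b))"
      unfolding 1 using carr by (simp add: m_ac l_distr r_distr)
    finally show "fraction R S (fst u \<otimes> snd p \<oplus> fst p \<otimes> snd u, snd u \<otimes> snd p) =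
        fraction R S (fst u \<otimes> snd q \<oplus> fst q \<otimes> snd u, snd u \<otimes> snd q)"
      using carr S_mult by (auto simp: p q fraction_eq_iff)
  qed
  from UN_equiv_class2[OF equiv_frac_rel equiv_frac_rel this, of "(r, s)" "(r', s')"] assms
  show ?thesis by (simp add: localization_def fraction_def case_prod_unfold)
qed

lemma one_localization: "\<one>\<^bsub>localization R S\<^esub> = fraction R S (\<one>, \<one>)"
  and zero_localization: "\<zero>\<^bsub>localization R S\<^esub> = fraction R S (\<zero>, \<one>)"
  by (simp_all add: localization_def)

lemma cring_localization: "cring (localization R S)"
proof -
  have in_carrier: "fraction R S (r, s) \<in> carrier (localization R S)" if "r \<in> carrier R" "s \<in> S" for r s
    using that by (auto simp: carrier_localization)
  have elim: thesis if "A \<in> carrier (localization R S)"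
    "\<And>r s. A = fraction R S (r, s) \<Longrightarrow> r \<in> carrier R \<Longrightarrow> s \<in> S \<Longrightarrow> s \<in> carrier R \<Longrightarrow> thesis"
    for A thesis
    using that S_carrier by (auto simp: carrier_localization)
  note simps = in_carrier mult_localization add_localization one_localization
    zero_localization S_carrier S_mult S_one
  have "abelian_group (localization R S)"
  proof (rule abelian_groupI)
    fix A assume "A \<in> carrier (localization R S)"
    then obtain r s where *: "A = fraction R S (r, s)" "r \<in> carrier R" "s \<in> S" "s \<in> carrier R"
      by (rule elim)
    then have "fraction R S (\<ominus> r, s) \<oplus>\<^bsub>localization R S\<^esub> A = fraction R S (\<zero>, s \<otimes> s)"
      by (simp add: simps l_minus l_neg)
    also have "\<dots> = \<zero>\<^bsub>localization R S\<^esub>"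
      unfolding zero_localization by (rule fraction_eqI) (use * in \<open>simp_all add: simps\<close>)
    finally show "\<exists>B\<in>carrier (localization R S). B \<oplus>\<^bsub>localization R S\<^esub> A = \<zero>\<^bsub>localization R S\<^esub>"
      using * in_carrier by blast
  qed (auto elim!: elim simp: simps l_distr r_distr m_ac a_ac intro!: fraction_eqI)
  moreover have "comm_monoid (localization R S)"
    by (rule comm_monoidI) (auto elim!: elim simp: simps m_ac intro!: fraction_eqI)
  ultimately show ?thesis
  proof (rule cringI)
    fix A B C
    assume A: "A \<in> carrier (localization R S)" and B: "B \<in> carrier (localization R S)"
      and C: "C \<in> carrier (localization R S)"
    from A obtain a s where 1: "A = fraction R S (a, s)" "a \<in> carrier R" "s \<in> S" "s \<in> carrier R"
      by (rule elim)
    from B obtain b t where 2: "B = fraction R S (b, t)" "b \<in> carrier R" "t \<in> S" "t \<in> carrier R"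
      by (rule elim)
    from C obtain c u where 3: "C = fraction R S (c, u)" "c \<in> carrier R" "u \<in> S" "u \<in> carrier R"
      by (rule elim)
    have "fraction R S ((a \<otimes> t \<oplus> b \<otimes> s) \<otimes> c, s \<otimes> t \<otimes> u) =
        fraction R S (a \<otimes> c \<otimes> (t \<otimes> u) \<oplus> b \<otimes> c \<otimes> (s \<otimes> u), s \<otimes> u \<otimes> (t \<otimes> u))"
      by (rule fraction_eqI) (use 1 2 3 in \<open>simp_all add: simps l_distr r_distr m_ac a_ac\<close>)
    then show "(A \<oplus>\<^bsub>localization R S\<^esub> B) \<otimes>\<^bsub>localization R S\<^esub> C =
        A \<otimes>\<^bsub>localization R S\<^esub> C \<oplus>\<^bsub>localization R S\<^esub> B \<otimes>\<^bsub>localization R S\<^esub> C"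
      using 1 2 3 by (simp add: simps)
  qed
qed

end

section \<open>Locally stable rings\<close>

text \<open>\<open>PIdl a\<close> is the principal ideal \<open>aR\<close> and \<open><+>\<close> is the sum of subsets.\<close>

definition comaximal :: "('a, 'm) ring_scheme \<Rightarrow> 'a \<Rightarrow> 'a \<Rightarrow> bool" where
  "comaximal R a b \<longleftrightarrow> PIdl\<^bsub>R\<^esub> a <+>\<^bsub>R\<^esub> PIdl\<^bsub>R\<^esub> b = carrier R"

definition comaximal_set :: "('a, 'm) ring_scheme \<Rightarrow> 'a \<Rightarrow> 'a set" where
  "comaximal_set R a = {b \<in> carrier R. comaximal R a b}"

text \<open>The ring \<open>R\<^sub>a\<close>. This is not the localization at the powers of \<open>a\<close>.\<close>

definition comaximal_localization :: "('a, 'm) ring_scheme \<Rightarrow> 'a \<Rightarrow> ('a \<times> 'a) set ring" where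
  "comaximal_localization R a = localization R (comaximal_set R a)"

definition stable_range_1 :: "('a, 'm) ring_scheme \<Rightarrow> bool" where
  "stable_range_1 R \<longleftrightarrow> (\<forall>c\<in>carrier R. \<forall>d\<in>carrier R. comaximal R c d \<longrightarrow>
     (\<exists>y\<in>carrier R. c \<oplus>\<^bsub>R\<^esub> d \<otimes>\<^bsub>R\<^esub> y \<in> Units R))"

definition locally_stable :: "('a, 'm) ring_scheme \<Rightarrow> bool" where
  "locally_stable R \<longleftrightarrow> (\<forall>c\<in>carrier R. \<forall>d\<in>carrier R. comaximal R c d \<longrightarrow>
     (\<exists>y\<in>carrier R. stable_range_1 (comaximal_localization R (c \<oplus>\<^bsub>R\<^esub> d \<otimes>\<^bsub>R\<^esub> y))))"

lemma (in cring) comaximal_iff: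
  assumes "a \<in> carrier R" "b \<in> carrier R"
  shows "comaximal R a b \<longleftrightarrow> (\<exists>x\<in>carrier R. \<exists>y\<in>carrier R. a \<otimes> x \<oplus> b \<otimes> y = \<one>)"
proof -
  have "ideal (PIdl a <+> PIdl b) R"
    by (intro add_ideals cgenideal_ideal assms)
  then have "comaximal R a b \<longleftrightarrow> \<one> \<in> PIdl a <+> PIdl b"
    unfolding comaximal_def using ideal.one_imp_carrier one_closed by blast
  also have "\<dots> \<longleftrightarrow> (\<exists>x\<in>carrier R. \<exists>y\<in>carrier R. a \<otimes> x \<oplus> b \<otimes> y = \<one>)"
    using assms by (auto simp: set_add_def' cgenideal_def) (metis m_comm)+
  finally show ?thesis .
qed

lemma (in cring) submonoid_comaximal_set:
  assumes a: "a \<in> carrier R"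
  shows "submonoid (comaximal_set R a) R"
proof
  show "comaximal_set R a \<subseteq> carrier R"
    by (auto simp: comaximal_set_def)
  have "a \<otimes> \<zero> \<oplus> \<one> \<otimes> \<one> = \<one>"
    using a by simp
  then show "\<one> \<in> comaximal_set R a"
    using a by (auto simp: comaximal_set_def comaximal_iff simp del: r_null r_one l_one)
  fix b c assume "b \<in> comaximal_set R a" "c \<in> comaximal_set R a"
  then obtain x y x' y' where
    mem: "b \<in> carrier R" "c \<in> carrier R" "x \<in> carrier R" "y \<in> carrier R"
      "x' \<in> carrier R" "y' \<in> carrier R"
    and 1: "a \<otimes> x \<oplus> b \<otimes> y = \<one>" and 2: "a \<otimes> x' \<oplus> c \<otimes> y' = \<one>"
    using a by (auto simp: comaximal_set_def comaximal_iff)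
  have "a \<otimes> (x \<oplus> b \<otimes> y \<otimes> x') \<oplus> (b \<otimes> c) \<otimes> (y \<otimes> y') =
      a \<otimes> x \<oplus> b \<otimes> y \<otimes> (a \<otimes> x' \<oplus> c \<otimes> y')"
    using a mem by (simp add: m_ac a_ac l_distr r_distr)
  also have "\<dots> = \<one>"
    using 1 2 a mem by simp
  finally show "b \<otimes> c \<in> comaximal_set R a"
    using a mem comaximal_iff[OF a, of "b \<otimes> c"] unfolding comaximal_set_def
    by (metis (no_types, lifting) a_closed m_closed mem_Collect_eq)
qed

section \<open>Elementary divisor rings and Bezout rings\<close>

text \<open>
  The type \<open>'a mat\<close> only supplies dimensions and entries. Its arithmetic refers to type classes on
  \<open>'a\<close>, so the product and the identity over the ring \<open>R\<close> are given here. Row and column indices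
  start at \<open>0\<close>, and dimension \<open>0\<close> is allowed (such matrices are trivially reduced).
\<close>

definition mats_over :: "('a, 'm) ring_scheme \<Rightarrow> nat \<Rightarrow> nat \<Rightarrow> 'a mat set" where
  "mats_over R m n = {A \<in> carrier_mat m n. elements_mat A \<subseteq> carrier R}"

definition mult_over :: "('a, 'm) ring_scheme \<Rightarrow> 'a mat \<Rightarrow> 'a mat \<Rightarrow> 'a mat" where
  "mult_over R A B = mat (dim_row A) (dim_col B)
     (\<lambda>(i, j). \<Oplus>\<^bsub>R\<^esub>k\<in>{0..<dim_col A}. A $$ (i, k) \<otimes>\<^bsub>R\<^esub> B $$ (k, j))"

definition one_over :: "('a, 'm) ring_scheme \<Rightarrow> nat \<Rightarrow> 'a mat" where
  "one_over R n = mat n n (\<lambda>(i, j). if i = j then \<one>\<^bsub>R\<^esub> else \<zero>\<^bsub>R\<^esub>)"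

definition invertible_mats_over :: "('a, 'm) ring_scheme \<Rightarrow> nat \<Rightarrow> 'a mat set" where
  "invertible_mats_over R n = {P \<in> mats_over R n n.
     \<exists>P'\<in>mats_over R n n. mult_over R P P' = one_over R n \<and> mult_over R P' P = one_over R n}"

definition admits_diagonal_reduction :: "('a, 'm) ring_scheme \<Rightarrow> 'a mat \<Rightarrow> bool" where
  "admits_diagonal_reduction R A \<longleftrightarrow>
     (\<exists>P\<in>invertible_mats_over R (dim_row A). \<exists>Q\<in>invertible_mats_over R (dim_col A).
        let D = mult_over R (mult_over R P A) Q in
        (\<forall>i<dim_row A. \<forall>j<dim_col A. i \<noteq> j \<longrightarrow> D $$ (i, j) = \<zero>\<^bsub>R\<^esub>) \<and>
        (\<forall>i. Suc i < min (dim_row A) (dim_col A) \<longrightarrow>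
           D $$ (i, i) divides\<^bsub>R\<^esub> D $$ (Suc i, Suc i)))"

definition elementary_divisor_ring :: "('a, 'm) ring_scheme \<Rightarrow> bool" where
  "elementary_divisor_ring R \<longleftrightarrow>
     (\<forall>m n. \<forall>A\<in>mats_over R m n. admits_diagonal_reduction R A)"

definition bezout_ring :: "('a, 'm) ring_scheme \<Rightarrow> bool" where
  "bezout_ring R \<longleftrightarrow>
     (\<forall>A. finite A \<and> A \<subseteq> carrier R \<longrightarrow> principalideal (Idl\<^bsub>R\<^esub> A) R)"

end

theory Submission
  imports Defs
begin

text \<open>
  The element \<open>e\<close> lies in the Jacobson radical of \<open>R\<^sub>e\<close>, and \<open>R\<^sub>e/eR\<^sub>e = R/eR\<close>. So if \<open>R\<^sub>e\<close> has stable
  range 1, then so has \<open>R/eR\<close>, and so has \<open>R/gR\<close> for every divisor \<open>g\<close> of \<open>e\<close>.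

  Let \<open>R\<close> be locally stable. If \<open>(a, b, c)\<close> is unimodular with \<open>au + bv + cw = 1\<close>, one replaces \<open>a\<close>
  by \<open>e = a + (bv + cw)y\<close> with \<open>R/eR\<close> of stable range 1 and makes \<open>b + cz\<close> invertible modulo \<open>e\<close>.
  Hence \<open>R\<close> has stable range 2, and if \<open>R\<close> is also Bezout, then it is a Hermite ring.

  By a theorem of Kaplansky it remains to find, for \<open>A\<close> upper triangular with rows \<open>(a, b)\<close> and \<open>(0, c)\<close> and
  unimodular entries, vectors \<open>p\<close> and \<open>q\<close> with \<open>p\<^sup>T A q = 1\<close>. Elementary operations replace \<open>b\<close> by
  some \<open>e\<close> with \<open>R/eR\<close> of stable range 1. Put \<open>g = gcd(a, e)\<close>, \<open>a = ga'\<close>, \<open>e = ge'\<close> and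
  \<open>a'x + e'x' = 1\<close>. Then \<open>t = x' + a'z\<close> is invertible modulo \<open>g\<close> for some \<open>z\<close>, and the column
  \<open>q = (x - e'z, t)\<close> has the unimodular image \<open>A q = (g, ct)\<close>.
\<close>

section \<open>Unimodular rows over locally stable rings\<close>

context cring
begin

section \<open>Comaximality as invertibility modulo an element\<close>

lemma comaximalI:
  assumes "a \<in> carrier R" "b \<in> carrier R" "x \<in> carrier R" "y \<in> carrier R"
    and "a \<otimes> x \<oplus> b \<otimes> y = \<one>"
  shows "comaximal R a b"
  using assms comaximal_iff by blast

lemma comaximalE:
  assumes "comaximal R a b" "a \<in> carrier R" "b \<in> carrier R"
  obtains x y where "x \<in> carrier R" "y \<in> carrier R" "a \<otimes> x \<oplus> b \<otimes> y = \<one>"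
  using assms comaximal_iff by blast

lemma comaximal_sym:
  assumes "comaximal R a b" "a \<in> carrier R" "b \<in> carrier R"
  shows "comaximal R b a"
  using assms by (metis comaximal_iff a_comm m_closed)

lemma comaximal_mult:
  assumes "comaximal R e p" "comaximal R e q" "e \<in> carrier R" "p \<in> carrier R" "q \<in> carrier R"
  shows "comaximal R e (p \<otimes> q)"
  using submonoid.m_closed[OF submonoid_comaximal_set[of e], of p q] assms
  by (simp add: comaximal_set_def)

lemma comaximal_factor:
  assumes "comaximal R e (p \<otimes> q)" "e \<in> carrier R" "p \<in> carrier R" "q \<in> carrier R"
  shows "comaximal R e p"
proof -
  from assms obtain x y where "x \<in> carrier R" "y \<in> carrier R" "e \<otimes> x \<oplus> (p \<otimes> q) \<otimes> y = \<one>"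
    by (auto elim: comaximalE)
  with assms show ?thesis
    by (intro comaximalI[of e p x "q \<otimes> y"]) (auto simp: m_assoc)
qed

text \<open>Invertibility of \<open>p\<close> modulo \<open>e\<close> depends only on the residue
  class of \<open>p\<close>: the coefficient of \<open>e\<close> absorbs the change.\<close>

lemma comaximal_add_mult:
  assumes "comaximal R e p" "e \<in> carrier R" "p \<in> carrier R" "q \<in> carrier R"
  shows "comaximal R e (p \<oplus> e \<otimes> q)"
proof -
  from assms obtain x y where xy: "x \<in> carrier R" "y \<in> carrier R" "e \<otimes> x \<oplus> p \<otimes> y = \<one>"
    by (auto elim: comaximalE)
  have "e \<otimes> (x \<oplus> \<ominus> (q \<otimes> y)) \<oplus> (p \<oplus> e \<otimes> q) \<otimes> y =
      (e \<otimes> x \<oplus> p \<otimes> y) \<oplus> e \<otimes> (q \<otimes> y \<oplus> \<ominus> (q \<otimes> y))"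
    using assms xy(1,2) by (simp add: l_distr r_distr m_ac a_ac del: r_neg)
  also have "\<dots> = \<one>"
    using assms xy by (simp add: r_neg)
  finally show ?thesis
    using assms xy by (intro comaximalI[of e _ "x \<oplus> \<ominus> (q \<otimes> y)" y]) auto
qed

text \<open>\<open>R/eR\<close> has stable range 1, with units modulo \<open>e\<close> read as elements comaximal with \<open>e\<close>.\<close>

definition quotient_sr1 :: "'a \<Rightarrow> bool" where
  "quotient_sr1 e \<longleftrightarrow> (\<forall>b\<in>carrier R. \<forall>f\<in>carrier R. \<forall>x\<in>carrier R. \<forall>y\<in>carrier R. \<forall>z\<in>carrier R.
     b \<otimes> x \<oplus> f \<otimes> y \<oplus> e \<otimes> z = \<one> \<longrightarrow> (\<exists>t\<in>carrier R. comaximal R e (b \<oplus> f \<otimes> t)))"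

text \<open>No quotient ring is formed. A relation \<open>b x + f y = 1\<close> modulo
  \<open>e\<close> makes \<open>b\<close> and \<open>f\<close> comaximal in the localization, where
  stable range 1 yields a unit. Its numerator is invertible modulo \<open>e\<close>, and so are all
  denominators, which can therefore be cleared.\<close>

lemma quotient_sr1_comaximal_localization:
  assumes e: "e \<in> carrier R" and sr: "stable_range_1 (comaximal_localization R e)"
  shows "quotient_sr1 e"
  unfolding quotient_sr1_def
proof (intro ballI impI)
  fix b f x y z
  assume carr: "b \<in> carrier R" "f \<in> carrier R" "x \<in> carrier R" "y \<in> carrier R" "z \<in> carrier R"
    and eq: "b \<otimes> x \<oplus> f \<otimes> y \<oplus> e \<otimes> z = \<one>"
  define S where "S = comaximal_set R e"
  define L where "L = localization R S"
  have sub: "submonoid S R"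
    unfolding S_def by (rule submonoid_comaximal_set[OF e])
  have S_iff: "s \<in> S \<longleftrightarrow> s \<in> carrier R \<and> comaximal R e s" for s
    by (auto simp: S_def comaximal_set_def)
  have S_carr: "s \<in> carrier R" if "s \<in> S" for s
    using that S_iff by blast
  have S_mult: "s \<otimes> t \<in> S" if "s \<in> S" "t \<in> S" for s t
    by (rule submonoid.m_closed[OF sub that])
  have S_one: "\<one> \<in> S"
    by (rule submonoid.one_closed[OF sub])
  note carrL = carrier_localization[OF is_cring sub, folded L_def]
  note multL = mult_localization[OF is_cring sub, folded L_def]
  note addL = add_localization[OF is_cring sub, folded L_def]
  note oneL = one_localization[OF is_cring sub, folded L_def]
  note eqL = fraction_eq_iff[OF is_cring sub]
  interpret L: cring L
    unfolding L_def by (rule cring_localization[OF is_cring sub])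
  \<comment> \<open>The element \<open>s\<close> equals \<open>1 - e z\<close>, so it lies in
    \<open>S\<close> and may serve as a common denominator of the coefficients.\<close>
  define s where "s = b \<otimes> x \<oplus> f \<otimes> y"
  have s: "s \<in> S"
    using carr e eq unfolding S_iff s_def
    by (auto intro!: comaximalI[of e _ z \<one>] simp: a_ac)
  have s_carr: "s \<in> carrier R"
    using s S_carr by blast
  have mem: "fraction R S (r, t) \<in> carrier L" if "r \<in> carrier R" "t \<in> S" for r t
    using that carrL by blast
  have "fraction R S (b, \<one>) \<otimes>\<^bsub>L\<^esub> fraction R S (x, s) \<oplus>\<^bsub>L\<^esub> fraction R S (f, \<one>) \<otimes>\<^bsub>L\<^esub> fraction R S (y, s)
      = fraction R S (s \<otimes> s, s \<otimes> s)"
    using carr s s_carr S_one by (simp add: multL addL l_distr[symmetric] s_def[symmetric])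
  also have "\<dots> = \<one>\<^bsub>L\<^esub>"
    unfolding oneL by (subst eqL) (use s s_carr S_one S_mult in auto)
  finally have "comaximal L (fraction R S (b, \<one>)) (fraction R S (f, \<one>))"
    using carr s S_one by (intro L.comaximalI[of _ _ "fraction R S (x, s)" "fraction R S (y, s)"] mem)
  then obtain Y where Y: "Y \<in> carrier L"
    and unit: "fraction R S (b, \<one>) \<oplus>\<^bsub>L\<^esub> fraction R S (f, \<one>) \<otimes>\<^bsub>L\<^esub> Y \<in> Units L"
    using sr carr S_one mem unfolding comaximal_localization_def stable_range_1_def S_def[symmetric]
      L_def[symmetric] by blast
  from Y obtain y' s' where y': "Y = fraction R S (y', s')" "y' \<in> carrier R" "s' \<in> S"
    unfolding carrL by blast
  have s'_carr: "s' \<in> carrier R"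
    using y' S_carr by blast
  define N where "N = b \<otimes> s' \<oplus> f \<otimes> y'"
  have N: "N \<in> carrier R"
    using carr y' s'_carr by (simp add: N_def)
  have "fraction R S (b, \<one>) \<oplus>\<^bsub>L\<^esub> fraction R S (f, \<one>) \<otimes>\<^bsub>L\<^esub> Y = fraction R S (N, s')"
    using carr y' s'_carr S_one by (simp add: multL addL N_def)
  with unit obtain V where V: "V \<in> carrier L" "fraction R S (N, s') \<otimes>\<^bsub>L\<^esub> V = \<one>\<^bsub>L\<^esub>"
    using L.Units_r_inv L.Units_inv_closed by metis
  from V(1) obtain r t where r: "V = fraction R S (r, t)" "r \<in> carrier R" "t \<in> S"
    unfolding carrL by blast
  have "fraction R S (N \<otimes> r, s' \<otimes> t) = fraction R S (\<one>, \<one>)"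
    using V(2) r y' N by (simp add: multL oneL)
  \<comment> \<open>Equality of fractions holds only up to a factor \<open>u\<close> in
    \<open>S\<close>. The resulting product \<open>N r u = u s' t\<close> still lies in
    \<open>S\<close>, hence so does its factor \<open>N\<close>.\<close>
  then obtain u where u: "u \<in> S" "u \<otimes> (N \<otimes> r \<otimes> \<one>) = u \<otimes> (\<one> \<otimes> (s' \<otimes> t))"
    using N r y' S_mult S_one by (subst (asm) eqL) auto
  have u_carr: "u \<in> carrier R" and t_carr: "t \<in> carrier R"
    using u r S_carr by auto
  have "N \<otimes> (r \<otimes> u) = u \<otimes> (s' \<otimes> t)"
    using u(2) N r u_carr t_carr s'_carr by (simp add: m_ac)
  then have "comaximal R e (N \<otimes> (r \<otimes> u))"
    using S_mult u(1) y'(3) r(3) S_iff by simp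
  then have eN: "comaximal R e N"
    using comaximal_factor e N r u_carr by blast
  \<comment> \<open>The element \<open>\<sigma>\<close> inverts \<open>s'\<close> modulo
    \<open>e\<close>. So \<open>N \<sigma>\<close> is congruent to \<open>b + f y' \<sigma>\<close>,
    and adding \<open>e \<tau> b\<close> makes this an equality.\<close>
  obtain \<sigma> \<tau> where st: "\<sigma> \<in> carrier R" "\<tau> \<in> carrier R" "e \<otimes> \<tau> \<oplus> s' \<otimes> \<sigma> = \<one>"
    using y'(3) S_iff e by (metis comaximalE)
  have e\<sigma>: "comaximal R e \<sigma>"
    using st e s'_carr by (intro comaximalI[of e \<sigma> \<tau> s']) (auto simp: m_ac)
  have "comaximal R e (N \<otimes> \<sigma> \<oplus> e \<otimes> (\<tau> \<otimes> b))"
    using comaximal_add_mult[OF comaximal_mult[OF eN e\<sigma>]] e N st carr by simp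
  also have "N \<otimes> \<sigma> \<oplus> e \<otimes> (\<tau> \<otimes> b) = b \<otimes> (e \<otimes> \<tau> \<oplus> s' \<otimes> \<sigma>) \<oplus> f \<otimes> (y' \<otimes> \<sigma>)"
    using e st(1,2) carr y' s'_carr by (simp add: N_def l_distr r_distr m_ac a_ac)
  also have "\<dots> = b \<oplus> f \<otimes> (y' \<otimes> \<sigma>)"
    using carr st by simp
  finally show "\<exists>t\<in>carrier R. comaximal R e (b \<oplus> f \<otimes> t)"
    using y' st by blast
qed

section \<open>Stable range 2, the Hermite property and triangular 2 x 2 matrices\<close>

lemma locally_stable_quotient_sr1:
  assumes "locally_stable R" "comaximal R c d" "c \<in> carrier R" "d \<in> carrier R"
  obtains y where "y \<in> carrier R" "quotient_sr1 (c \<oplus> d \<otimes> y)"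
  using assms quotient_sr1_comaximal_localization unfolding locally_stable_def
  by (metis a_closed m_closed)

lemma quotient_sr1D:
  assumes "quotient_sr1 e" "b \<in> carrier R" "f \<in> carrier R" "x \<in> carrier R" "y \<in> carrier R"
    "z \<in> carrier R" "b \<otimes> x \<oplus> f \<otimes> y \<oplus> e \<otimes> z = \<one>"
  obtains t where "t \<in> carrier R" "comaximal R e (b \<oplus> f \<otimes> t)"
  using assms unfolding quotient_sr1_def by blast

text \<open>First \<open>a\<close> is moved to an \<open>e\<close> whose quotient has stable range
  1, which spoils the shape \<open>a + c s\<close> by a multiple of \<open>b\<close>. This is
  repaired by subtracting a multiple of the second entry from the first, which preserves
  comaximality.\<close>

lemma locally_stable_sr2:
  assumes ls: "locally_stable R"
    and carr: "a \<in> carrier R" "b \<in> carrier R" "c \<in> carrier R"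
      "u \<in> carrier R" "v \<in> carrier R" "w \<in> carrier R"
    and eq: "a \<otimes> u \<oplus> b \<otimes> v \<oplus> c \<otimes> w = \<one>"
  obtains s t where "s \<in> carrier R" "t \<in> carrier R" "comaximal R (a \<oplus> c \<otimes> s) (b \<oplus> c \<otimes> t)"
proof -
  have "comaximal R a (b \<otimes> v \<oplus> c \<otimes> w)"
    by (rule comaximalI[of _ _ u \<one>]) (use carr eq in \<open>auto simp: a_ac\<close>)
  then obtain y where y: "y \<in> carrier R" and sr: "quotient_sr1 (a \<oplus> (b \<otimes> v \<oplus> c \<otimes> w) \<otimes> y)"
    by (rule locally_stable_quotient_sr1[OF ls]) (use carr in auto)
  define e where "e = a \<oplus> (b \<otimes> v \<oplus> c \<otimes> w) \<otimes> y"
  have e: "e \<in> carrier R"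
    using carr y by (simp add: e_def)
  \<comment> \<open>Since \<open>e u\<close> exceeds \<open>a u\<close> by
    \<open>(b v + c w) y u\<close>, the coefficients of \<open>b\<close> and \<open>c\<close> are
    scaled by \<open>1 - y u\<close>.\<close>
  define n where "n = \<ominus> (y \<otimes> u)"
  have n: "n \<in> carrier R" "y \<otimes> u \<oplus> n = \<zero>"
    using carr y by (auto simp: n_def r_neg)
  have "b \<otimes> (v \<oplus> v \<otimes> n) \<oplus> c \<otimes> (w \<oplus> w \<otimes> n) \<oplus> e \<otimes> u =
      (a \<otimes> u \<oplus> b \<otimes> v \<oplus> c \<otimes> w) \<oplus> (b \<otimes> v \<oplus> c \<otimes> w) \<otimes> (y \<otimes> u \<oplus> n)"
    using carr y n(1) by (simp add: e_def l_distr r_distr m_ac a_ac)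
  also have "\<dots> = \<one>"
    using eq n carr by simp
  finally have eq': "b \<otimes> (v \<oplus> v \<otimes> n) \<oplus> c \<otimes> (w \<oplus> w \<otimes> n) \<oplus> e \<otimes> u = \<one>" .
  obtain z where z: "z \<in> carrier R" "comaximal R e (b \<oplus> c \<otimes> z)"
    by (rule quotient_sr1D[OF sr[folded e_def] carr(2,3) _ _ carr(4) eq']) (use carr n in auto)
  \<comment> \<open>Subtracting \<open>v y\<close> times \<open>b + c z\<close> from
    \<open>e\<close> cancels the multiple of \<open>b\<close> that \<open>e\<close> contains beyond
    \<open>a\<close>.\<close>
  define m where "m = \<ominus> (v \<otimes> y)"
  have m: "m \<in> carrier R" "v \<otimes> y \<oplus> m = \<zero>"
    using carr y by (auto simp: m_def r_neg)
  have "comaximal R (b \<oplus> c \<otimes> z) (e \<oplus> (b \<oplus> c \<otimes> z) \<otimes> m)"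
    using comaximal_add_mult[OF comaximal_sym[OF z(2)]] z e carr m by simp
  also have "e \<oplus> (b \<oplus> c \<otimes> z) \<otimes> m = a \<oplus> c \<otimes> (w \<otimes> y \<oplus> z \<otimes> m) \<oplus> b \<otimes> (v \<otimes> y \<oplus> m)"
    using carr y z m(1) by (simp add: e_def l_distr r_distr m_ac a_ac)
  also have "\<dots> = a \<oplus> c \<otimes> (w \<otimes> y \<oplus> z \<otimes> m)"
    using carr y z m by simp
  finally show thesis
    using that[of "w \<otimes> y \<oplus> z \<otimes> m" z] carr y z m by (simp add: comaximal_sym)
qed

lemma bezout_gcd:
  assumes "bezout_ring R" "a \<in> carrier R" "b \<in> carrier R"
  obtains d a' b' x y where "d \<in> carrier R" "a' \<in> carrier R" "b' \<in> carrier R" "x \<in> carrier R"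
    "y \<in> carrier R" "a = d \<otimes> a'" "b = d \<otimes> b'" "d = a \<otimes> x \<oplus> b \<otimes> y"
proof -
  have "principalideal (Idl {a, b}) R"
    using assms unfolding bezout_ring_def by simp
  then obtain d where d: "d \<in> carrier R" "Idl {a, b} = Idl {d}"
    using principalideal.generate by blast
  then have gen: "Idl {a, b} = PIdl d"
    by (simp add: cgenideal_eq_genideal)
  have "a \<in> Idl {a, b}" "b \<in> Idl {a, b}"
    using genideal_self[of "{a, b}"] assms by auto
  then obtain a' b' where 1: "a' \<in> carrier R" "b' \<in> carrier R" "a = d \<otimes> a'" "b = d \<otimes> b'"
    unfolding gen cgenideal_def using d m_comm by auto
  have "ideal (PIdl a <+> PIdl b) R"
    by (intro add_ideals cgenideal_ideal assms)
  moreover have "\<zero> \<in> PIdl a" "\<zero> \<in> PIdl b"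
    using assms by (simp_all add: additive_subgroup.zero_closed cgenideal_ideal ideal.axioms(1))
  then have "a \<in> PIdl a <+> PIdl b" "b \<in> PIdl a <+> PIdl b"
    using assms cgenideal_self[of a] cgenideal_self[of b] unfolding set_add_def'
    by (force simp: r_zero l_zero)+
  ultimately have "Idl {a, b} \<subseteq> PIdl a <+> PIdl b"
    by (intro genideal_minimal) auto
  moreover have "d \<in> Idl {a, b}"
    using d genideal_self' by simp
  ultimately obtain x y where "x \<in> carrier R" "y \<in> carrier R" "d = x \<otimes> a \<oplus> y \<otimes> b"
    by (auto simp: set_add_def' cgenideal_def)
  with 1 d assms that show thesis
    by (metis m_comm)
qed

text \<open>With zero divisors, the cofactors of a gcd need not be comaximal:
  \<open>d (a0 x + b0 y) = d\<close> only gives \<open>d c = 0\<close> for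
  \<open>c = 1 - (a0 x + b0 y)\<close>. But \<open>(a0, b0, c)\<close> is unimodular, and stable
  range 2 absorbs \<open>c\<close> into the cofactors without changing their products with
  \<open>d\<close>.\<close>

lemma hermite:
  assumes bez: "bezout_ring R" and ls: "locally_stable R" and ab: "a \<in> carrier R" "b \<in> carrier R"
  obtains g a' b' x y where "g \<in> carrier R" "a' \<in> carrier R" "b' \<in> carrier R" "x \<in> carrier R"
    "y \<in> carrier R" "a = g \<otimes> a'" "b = g \<otimes> b'" "a' \<otimes> x \<oplus> b' \<otimes> y = \<one>"
proof -
  obtain d a0 b0 x y where carr: "d \<in> carrier R" "a0 \<in> carrier R" "b0 \<in> carrier R" "x \<in> carrier R"
    "y \<in> carrier R" and eq: "a = d \<otimes> a0" "b = d \<otimes> b0" "d = a \<otimes> x \<oplus> b \<otimes> y"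
    using bezout_gcd[OF bez ab] .
  define k where "k = a0 \<otimes> x \<oplus> b0 \<otimes> y"
  define c where "c = \<one> \<ominus> k"
  have k: "k \<in> carrier R" and c: "c \<in> carrier R"
    using carr by (auto simp: k_def c_def)
  have "d \<otimes> k = d"
    using carr eq(3) unfolding eq(1,2) k_def by (simp add: r_distr m_assoc)
  then have dc: "d \<otimes> c = \<zero>"
    using carr k by (simp add: c_def minus_eq r_distr r_minus r_neg)
  have "a0 \<otimes> x \<oplus> b0 \<otimes> y \<oplus> c \<otimes> \<one> = \<one>"
    using k unfolding k_def[symmetric] by (simp add: c_def minus_eq a_lcomm[of k] r_neg)
  then obtain s t where st: "s \<in> carrier R" "t \<in> carrier R"
    and cm: "comaximal R (a0 \<oplus> c \<otimes> s) (b0 \<oplus> c \<otimes> t)"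
    using locally_stable_sr2[OF ls] carr c one_closed by metis
  have "d \<otimes> (p \<oplus> c \<otimes> q) = d \<otimes> p" if "p \<in> carrier R" "q \<in> carrier R" for p q
    using that carr c dc by (simp add: r_distr m_assoc[symmetric])
  then show thesis
    using cm that[of d "a0 \<oplus> c \<otimes> s" "b0 \<oplus> c \<otimes> t"] carr c st eq(1,2)
    by (metis a_closed m_closed comaximal_iff)
qed

text \<open>The matrix with rows \<open>(a, b)\<close> and \<open>(0, c)\<close> sends the column
  \<open>(s, t)\<close> to the pair in the conclusion; the coefficients of its comaximality form the
  row that turns this image into 1.\<close>

lemma triangular_unimodular:
  assumes bez: "bezout_ring R" and ls: "locally_stable R"
    and carr: "a \<in> carrier R" "b \<in> carrier R" "c \<in> carrier R"
      "u \<in> carrier R" "v \<in> carrier R" "w \<in> carrier R"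
    and eq: "a \<otimes> u \<oplus> b \<otimes> v \<oplus> c \<otimes> w = \<one>"
  obtains s t where "s \<in> carrier R" "t \<in> carrier R" "comaximal R (a \<otimes> s \<oplus> b \<otimes> t) (c \<otimes> t)"
proof -
  have "comaximal R b (a \<otimes> u \<oplus> c \<otimes> w)"
    by (rule comaximalI[of _ _ v \<one>]) (use carr eq in \<open>auto simp: a_ac\<close>)
  then obtain y where y: "y \<in> carrier R" and sr: "quotient_sr1 (b \<oplus> (a \<otimes> u \<oplus> c \<otimes> w) \<otimes> y)"
    by (rule locally_stable_quotient_sr1[OF ls]) (use carr in auto)
  \<comment> \<open>On the matrix, passing from \<open>b\<close> to \<open>e\<close> means adding
    \<open>u y\<close> times the first column to the second and \<open>w y\<close> times the second
    row to the first.\<close>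
  define e where "e = b \<oplus> (a \<otimes> u \<oplus> c \<otimes> w) \<otimes> y"
  have e: "e \<in> carrier R"
    using carr y by (simp add: e_def)
  obtain g a' e' x x' where g: "g \<in> carrier R" "a' \<in> carrier R" "e' \<in> carrier R" "x \<in> carrier R"
    "x' \<in> carrier R" "a = g \<otimes> a'" "e = g \<otimes> e'" "a' \<otimes> x \<oplus> e' \<otimes> x' = \<one>"
    using hermite[OF bez ls carr(1) e] .
  define n where "n = \<ominus> (y \<otimes> v)"
  have n: "n \<in> carrier R" "y \<otimes> v \<oplus> n = \<zero>"
    using carr y by (auto simp: n_def r_neg)
  \<comment> \<open>The row \<open>(a, e, c)\<close> is still unimodular, and \<open>g\<close>
    divides its first two entries, so \<open>g\<close> is comaximal with \<open>c\<close>.\<close>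
  have "g \<otimes> (a' \<otimes> u \<oplus> e' \<otimes> v \<oplus> a' \<otimes> u \<otimes> n) \<oplus> c \<otimes> (w \<oplus> w \<otimes> n) =
      a \<otimes> u \<oplus> e \<otimes> v \<oplus> a \<otimes> u \<otimes> n \<oplus> c \<otimes> (w \<oplus> w \<otimes> n)"
    using carr g(1-5) n(1) unfolding g(6,7) by (simp add: r_distr m_ac)
  also have "\<dots> = (a \<otimes> u \<oplus> b \<otimes> v \<oplus> c \<otimes> w) \<oplus> (a \<otimes> u \<oplus> c \<otimes> w) \<otimes> (y \<otimes> v \<oplus> n)"
    using carr y n(1) by (simp add: e_def l_distr r_distr m_ac a_ac)
  also have "\<dots> = \<one>"
    using eq n carr by simp
  finally have gc: "comaximal R g c"
    using g carr n by (intro comaximalI[of g c "a' \<otimes> u \<oplus> e' \<otimes> v \<oplus> a' \<otimes> u \<otimes> n" "w \<oplus> w \<otimes> n"]) auto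
  \<comment> \<open>By \<open>x' e' + a' x = 1\<close>, a multiple of \<open>a'\<close> can be added
    to \<open>x'\<close> to give a unit modulo \<open>e\<close>, hence modulo the divisor
    \<open>g\<close> of \<open>e\<close>.\<close>
  have "x' \<otimes> e' \<oplus> a' \<otimes> x \<oplus> e \<otimes> \<zero> = \<one>"
    using g e by (simp add: m_ac a_ac)
  then obtain z where z: "z \<in> carrier R" "comaximal R e (x' \<oplus> a' \<otimes> z)"
    using quotient_sr1D[OF sr[folded e_def]] g zero_closed by metis
  define t where "t = x' \<oplus> a' \<otimes> z"
  have t: "t \<in> carrier R"
    using g z by (simp add: t_def)
  have "comaximal R t (g \<otimes> e')"
    using z t e g by (auto simp: t_def intro: comaximal_sym)
  then have "comaximal R g t"
    using comaximal_factor comaximal_sym g t by blast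
  then have "comaximal R g (c \<otimes> t)"
    using gc comaximal_mult g carr t by blast
  \<comment> \<open>The choice \<open>s = x - e' z\<close> compensates the shift in
    \<open>t\<close>: \<open>a' s + e' t = 1\<close>, so \<open>a s + e t = g\<close>.\<close>
  define m where "m = \<ominus> z"
  have m: "m \<in> carrier R" "m \<oplus> z = \<zero>"
    using z by (auto simp: m_def l_neg)
  define s where "s = x \<oplus> e' \<otimes> m"
  have s: "s \<in> carrier R"
    using g m by (simp add: s_def)
  have "a \<otimes> s \<oplus> e \<otimes> t = g \<otimes> ((a' \<otimes> x \<oplus> e' \<otimes> x') \<oplus> a' \<otimes> e' \<otimes> (m \<oplus> z))"
    using g(1-5) m(1) z(1) unfolding g(6,7) s_def t_def by (simp add: l_distr r_distr m_ac a_ac)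
  also have "\<dots> = g"
    using g m z by simp
  \<comment> \<open>Returning from \<open>e\<close> to \<open>b\<close> adds \<open>u y t\<close> to
    the first coefficient and leaves over a multiple of \<open>c t\<close>, which does not affect
    comaximality with \<open>c t\<close>.\<close>
  finally have "g = a \<otimes> (s \<oplus> u \<otimes> y \<otimes> t) \<oplus> b \<otimes> t \<oplus> (c \<otimes> t) \<otimes> (w \<otimes> y)"
    using carr y s t by (simp add: e_def l_distr r_distr m_ac a_ac)
  moreover define h where "h = a \<otimes> (s \<oplus> u \<otimes> y \<otimes> t) \<oplus> b \<otimes> t"
  moreover have h: "h \<in> carrier R"
    using carr y s t by (simp add: h_def)
  ultimately have "h = g \<oplus> (c \<otimes> t) \<otimes> (\<ominus> (w \<otimes> y))"
    using carr y t by (simp add: a_assoc r_minus r_neg)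
  moreover have "comaximal R (c \<otimes> t) (g \<oplus> (c \<otimes> t) \<otimes> (\<ominus> (w \<otimes> y)))"
    using comaximal_add_mult[OF comaximal_sym[OF \<open>comaximal R g (c \<otimes> t)\<close>]] g carr t y by simp
  ultimately have "comaximal R h (c \<otimes> t)"
    using h carr t by (auto intro: comaximal_sym)
  then show thesis
    using that[of "s \<oplus> u \<otimes> y \<otimes> t" t] carr y s t unfolding h_def by simp
qed

lemma hermite3:
  assumes bez: "bezout_ring R" and ls: "locally_stable R"
    and abc: "a \<in> carrier R" "b \<in> carrier R" "c \<in> carrier R"
  obtains g a' b' c' u v w where "g \<in> carrier R" "a' \<in> carrier R" "b' \<in> carrier R" "c' \<in> carrier R"
    "u \<in> carrier R" "v \<in> carrier R" "w \<in> carrier R" "a = g \<otimes> a'" "b = g \<otimes> b'" "c = g \<otimes> c'"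
    "a' \<otimes> u \<oplus> b' \<otimes> v \<oplus> c' \<otimes> w = \<one>"
proof -
  obtain h a1 b1 x y where h: "h \<in> carrier R" "a1 \<in> carrier R" "b1 \<in> carrier R" "x \<in> carrier R"
    "y \<in> carrier R" "a = h \<otimes> a1" "b = h \<otimes> b1" "a1 \<otimes> x \<oplus> b1 \<otimes> y = \<one>"
    using hermite[OF bez ls abc(1,2)] .
  obtain g h' c' z w where g: "g \<in> carrier R" "h' \<in> carrier R" "c' \<in> carrier R" "z \<in> carrier R"
    "w \<in> carrier R" "h = g \<otimes> h'" "c = g \<otimes> c'" "h' \<otimes> z \<oplus> c' \<otimes> w = \<one>"
    using hermite[OF bez ls h(1) abc(3)] .
  have "h' \<otimes> a1 \<otimes> (x \<otimes> z) \<oplus> h' \<otimes> b1 \<otimes> (y \<otimes> z) \<oplus> c' \<otimes> w =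
      h' \<otimes> z \<otimes> (a1 \<otimes> x \<oplus> b1 \<otimes> y) \<oplus> c' \<otimes> w"
    using h(1-5) g(1-5) by (simp add: r_distr m_ac a_ac)
  also have "\<dots> = \<one>"
    using h g by simp
  finally show thesis
    using that[of g "h' \<otimes> a1" "h' \<otimes> b1" c' "x \<otimes> z" "y \<otimes> z" w] h g by (simp add: m_assoc)
qed

section \<open>Reduction of matrices by unimodular operations on two rows or columns\<close>

text \<open>
  Matrices are total functions of a row and a column index, of which only a finite block of indices
  matters. Thus a submatrix is given by index sets, and operations on it need no embedding.
\<close>

definition over_carrier :: "(nat \<Rightarrow> nat \<Rightarrow> 'a) \<Rightarrow> bool" where
  "over_carrier A \<longleftrightarrow> (\<forall>r c. A r c \<in> carrier R)"

text \<open>Left multiplication by the matrix with the block \<open>x, y; z, w\<close> in positions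
  \<open>i\<close>, \<open>k\<close> and the identity elsewhere.\<close>

definition row_op :: "nat \<Rightarrow> nat \<Rightarrow> 'a \<Rightarrow> 'a \<Rightarrow> 'a \<Rightarrow> 'a \<Rightarrow> (nat \<Rightarrow> nat \<Rightarrow> 'a) \<Rightarrow> nat \<Rightarrow> nat \<Rightarrow> 'a" where
  "row_op i k x y z w A = (\<lambda>r c. if r = i then x \<otimes> A i c \<oplus> y \<otimes> A k c
     else if r = k then z \<otimes> A i c \<oplus> w \<otimes> A k c else A r c)"

text \<open>Defined through the transpose, so that facts on rows carry over. As a right
  multiplication it uses the transposed block.\<close>

definition col_op :: "nat \<Rightarrow> nat \<Rightarrow> 'a \<Rightarrow> 'a \<Rightarrow> 'a \<Rightarrow> 'a \<Rightarrow> (nat \<Rightarrow> nat \<Rightarrow> 'a) \<Rightarrow> nat \<Rightarrow> nat \<Rightarrow> 'a" where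
  "col_op j l x y z w A = (\<lambda>r c. row_op j l x y z w (\<lambda>c r. A r c) c r)"

text \<open>With determinant 1, rather than an arbitrary unit, the adjugate is the inverse; every
  unimodular pair is the first row of such a matrix.\<close>

definition sl2 :: "'a \<Rightarrow> 'a \<Rightarrow> 'a \<Rightarrow> 'a \<Rightarrow> bool" where
  "sl2 x y z w \<longleftrightarrow> x \<in> carrier R \<and> y \<in> carrier R \<and> z \<in> carrier R \<and> w \<in> carrier R \<and>
     x \<otimes> w \<ominus> y \<otimes> z = \<one>"

text \<open>The sets name the rows and columns that may be combined. An operation on rows of
  \<open>I\<close> still acts along whole rows, also in columns outside \<open>J\<close>, so later
  arguments must control those entries as well.\<close>

inductive reach :: "nat set \<Rightarrow> nat set \<Rightarrow> (nat \<Rightarrow> nat \<Rightarrow> 'a) \<Rightarrow> (nat \<Rightarrow> nat \<Rightarrow> 'a) \<Rightarrow> bool"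
  for I J A where
  refl: "reach I J A A"
| row: "reach I J A B \<Longrightarrow> i \<in> I \<Longrightarrow> k \<in> I \<Longrightarrow> i \<noteq> k \<Longrightarrow> sl2 x y z w \<Longrightarrow> reach I J A (row_op i k x y z w B)"
| col: "reach I J A B \<Longrightarrow> j \<in> J \<Longrightarrow> l \<in> J \<Longrightarrow> j \<noteq> l \<Longrightarrow> sl2 x y z w \<Longrightarrow> reach I J A (col_op j l x y z w B)"

lemma over_carrierD: "over_carrier A \<Longrightarrow> A r c \<in> carrier R"
  by (simp add: over_carrier_def)

lemma over_carrier_row_op: "over_carrier A \<Longrightarrow> sl2 x y z w \<Longrightarrow> over_carrier (row_op i k x y z w A)"
  by (auto simp: over_carrier_def row_op_def sl2_def)

lemma over_carrier_col_op: "over_carrier A \<Longrightarrow> sl2 x y z w \<Longrightarrow> over_carrier (col_op j l x y z w A)"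
  by (auto simp: over_carrier_def col_op_def row_op_def sl2_def)

text \<open>The second row \<open>(-b, a)\<close> annihilates \<open>(a, b)\<close>. Applied to
  \<open>(g a, g b)\<close>, the matrix yields \<open>(g, 0)\<close>.\<close>

lemma sl2I:
  assumes "a \<in> carrier R" "b \<in> carrier R" "x \<in> carrier R" "y \<in> carrier R" "a \<otimes> x \<oplus> b \<otimes> y = \<one>"
  shows "sl2 x y (\<ominus> b) a"
  using assms by (simp add: sl2_def minus_eq r_minus m_comm)

lemma sl2_inverse: "sl2 x y z w \<Longrightarrow> sl2 w (\<ominus> y) (\<ominus> z) x"
  by (auto simp: sl2_def minus_eq l_minus r_minus m_comm)

lemma row_op_inverse:
  assumes "over_carrier A" "i \<noteq> k" "sl2 x y z w"
  shows "row_op i k w (\<ominus> y) (\<ominus> z) x (row_op i k x y z w A) = A"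
proof -
  have carr: "x \<in> carrier R" "y \<in> carrier R" "z \<in> carrier R" "w \<in> carrier R"
    and det: "x \<otimes> w \<oplus> \<ominus> (y \<otimes> z) = \<one>"
    using assms by (auto simp: sl2_def minus_eq)
  define y' z' where "y' = \<ominus> y" and "z' = \<ominus> z"
  have 1: "y' \<in> carrier R" "z' \<in> carrier R" "y \<oplus> y' = \<zero>" "z \<oplus> z' = \<zero>"
    "x \<otimes> w \<oplus> y' \<otimes> z = \<one>" "x \<otimes> w \<oplus> y \<otimes> z' = \<one>"
    using carr det by (auto simp: y'_def z'_def r_neg l_minus r_minus)
  have "w \<otimes> (x \<otimes> a \<oplus> y \<otimes> b) \<oplus> y' \<otimes> (z \<otimes> a \<oplus> w \<otimes> b) = a"
    and "z' \<otimes> (x \<otimes> a \<oplus> y \<otimes> b) \<oplus> x \<otimes> (z \<otimes> a \<oplus> w \<otimes> b) = b"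
    if ab: "a \<in> carrier R" "b \<in> carrier R" for a b
  proof -
    have "w \<otimes> (x \<otimes> a \<oplus> y \<otimes> b) \<oplus> y' \<otimes> (z \<otimes> a \<oplus> w \<otimes> b) =
        (x \<otimes> w \<oplus> y' \<otimes> z) \<otimes> a \<oplus> (y \<oplus> y') \<otimes> (w \<otimes> b)"
      using carr 1(1,2) ab by (simp add: l_distr r_distr m_ac a_ac)
    then show "w \<otimes> (x \<otimes> a \<oplus> y \<otimes> b) \<oplus> y' \<otimes> (z \<otimes> a \<oplus> w \<otimes> b) = a"
      using carr ab 1 by simp
    have "z' \<otimes> (x \<otimes> a \<oplus> y \<otimes> b) \<oplus> x \<otimes> (z \<otimes> a \<oplus> w \<otimes> b) =
        (x \<otimes> w \<oplus> y \<otimes> z') \<otimes> b \<oplus> (z \<oplus> z') \<otimes> (x \<otimes> a)"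
      using carr 1(1,2) ab by (simp add: l_distr r_distr m_ac a_ac)
    then show "z' \<otimes> (x \<otimes> a \<oplus> y \<otimes> b) \<oplus> x \<otimes> (z \<otimes> a \<oplus> w \<otimes> b) = b"
      using carr ab 1 by simp
  qed
  then show ?thesis
    using assms(1,2) unfolding y'_def[symmetric] z'_def[symmetric]
    by (auto simp: row_op_def fun_eq_iff over_carrierD)
qed

lemma col_op_inverse:
  assumes "over_carrier A" "j \<noteq> l" "sl2 x y z w"
  shows "col_op j l w (\<ominus> y) (\<ominus> z) x (col_op j l x y z w A) = A"
proof -
  have "over_carrier (\<lambda>c r. A r c)"
    using assms(1) by (simp add: over_carrier_def)
  from row_op_inverse[OF this assms(2,3)] show ?thesis
    by (simp add: col_op_def)
qed

section \<open>Reachability, its invariants, and clearing with a pivot\<close>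

lemma reach_trans:
  assumes "reach I J A B" "reach I J B C"
  shows "reach I J A C"
  using assms(2,1) by induction (auto intro: reach.intros)

lemma reach_mono:
  assumes "reach I J A B" "I \<subseteq> I'" "J \<subseteq> J'"
  shows "reach I' J' A B"
  using assms by induction (auto intro!: reach.intros)

lemma reach_transpose:
  assumes "reach I J A B"
  shows "reach J I (\<lambda>r c. A c r) (\<lambda>r c. B c r)"
  using assms
proof induction
  case refl
  show ?case by (rule reach.refl)
next
  case (row B i k x y z w)
  from reach.col[OF row(6,2-5)] show ?case by (simp add: col_op_def)
next
  case (col B j l x y z w)
  from reach.row[OF col(6,2-5)] show ?case by (simp add: col_op_def)
qed

lemma reach_carrier:
  assumes "reach I J A B" "over_carrier A"
  shows "over_carrier B"
  using assms by induction (auto intro: over_carrier_row_op over_carrier_col_op)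

text \<open>Each operation is undone by its adjugate. Thus divisibility statements about the entries
  travel in both directions.\<close>

lemma reach_sym:
  assumes "reach I J A B" "over_carrier A"
  shows "reach I J B A"
  using assms
proof induction
  case refl
  show ?case by (rule reach.refl)
next
  case (row B i k x y z w)
  have "over_carrier B" using row reach_carrier by blast
  then have "reach I J (row_op i k x y z w B) B"
    using reach.row[OF reach.refl row(2-4) sl2_inverse[OF row(5)], where A = "row_op i k x y z w B"]
      row_op_inverse[OF _ row(4,5)] by simp
  then show ?case using row reach_trans by blast
next
  case (col B j l x y z w)
  have "over_carrier B" using col reach_carrier by blast
  then have "reach I J (col_op j l x y z w B) B"
    using reach.col[OF reach.refl col(2-4) sl2_inverse[OF col(5)], where A = "col_op j l x y z w B"]
      col_op_inverse[OF _ col(4,5)] by simp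
  then show ?case using col reach_trans by blast
qed

lemma reach_unchanged:
  assumes "reach I J A B" "r \<notin> I" "c \<notin> J"
  shows "B r c = A r c"
  using assms by induction (auto simp: col_op_def row_op_def)

lemma divides_lincomb:
  assumes "d divides a" "d divides b" "d \<in> carrier R" "x \<in> carrier R" "y \<in> carrier R"
  shows "d divides (x \<otimes> a \<oplus> y \<otimes> b)"
proof -
  from assms obtain p q where pq: "p \<in> carrier R" "q \<in> carrier R" "a = d \<otimes> p" "b = d \<otimes> q"
    by (auto simp: factor_def)
  then have "x \<otimes> a \<oplus> y \<otimes> b = d \<otimes> (x \<otimes> p \<oplus> y \<otimes> q)"
    using assms(3-5) by (simp add: r_distr m_ac)
  with pq assms(3-5) show ?thesis
    by (auto simp: factor_def intro!: bexI[of _ "x \<otimes> p \<oplus> y \<otimes> q"])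
qed

lemma zero_divides_iff: "\<zero> divides a \<longleftrightarrow> a = \<zero>"
  by (auto simp: factor_def)

text \<open>With \<open>d = \<zero>\<close> this says that blocks of zeros are preserved.\<close>

lemma reach_divides:
  assumes "reach I J A B" "d \<in> carrier R" "I \<subseteq> L \<or> I \<inter> L = {}" "J \<subseteq> K \<or> J \<inter> K = {}"
    and "\<forall>r\<in>L. \<forall>c\<in>K. d divides A r c"
  shows "\<forall>r\<in>L. \<forall>c\<in>K. d divides B r c"
  using assms
proof induction
  case refl
  then show ?case by simp
next
  case (row B i k x y z w)
  then have IH: "\<forall>r\<in>L. \<forall>c\<in>K. d divides B r c" by blast
  show ?case
  proof (intro ballI)
    fix r c assume "r \<in> L" "c \<in> K"
    then show "d divides row_op i k x y z w B r c"
      using IH row(2-5,7,8) by (auto simp: row_op_def sl2_def intro!: divides_lincomb)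
  qed
next
  case (col B j l x y z w)
  then have IH: "\<forall>r\<in>L. \<forall>c\<in>K. d divides B r c" by blast
  show ?case
  proof (intro ballI)
    fix r c assume "r \<in> L" "c \<in> K"
    then show "d divides col_op j l x y z w B r c"
      using IH col(2-5,7,9) by (auto simp: col_op_def row_op_def sl2_def intro!: divides_lincomb)
  qed
qed

text \<open>Multiples of column \<open>j\<close> are subtracted from the columns of
  \<open>F\<close>. Column \<open>j\<close> itself never changes, so the pivot and its column
  survive for the later clearing of that column.\<close>

lemma reach_clear_row:
  assumes "finite F" "j \<notin> F" "over_carrier A" "\<forall>c\<in>F. A i j divides A i c"
  obtains B where "reach {} (insert j F) A B" "\<forall>c\<in>F. B i c = \<zero>" "\<forall>r. \<forall>c. c \<notin> F \<longrightarrow> B r c = A r c"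
proof -
  have "\<exists>B. reach {} (insert j F) A B \<and> (\<forall>c\<in>F. B i c = \<zero>) \<and> (\<forall>r. \<forall>c. c \<notin> F \<longrightarrow> B r c = A r c)"
    using assms
  proof (induction F)
    case empty
    then show ?case using reach.refl by blast
  next
    case (insert k F)
    then obtain B where B: "reach {} (insert j F) A B" "\<forall>c\<in>F. B i c = \<zero>"
      "\<forall>r. \<forall>c. c \<notin> F \<longrightarrow> B r c = A r c"
      by auto
    have carr: "over_carrier B" using B(1) insert.prems(2) reach_carrier by blast
    from insert.prems obtain q where q: "q \<in> carrier R" "A i k = A i j \<otimes> q"
      by (auto simp: factor_def)
    have sl: "sl2 \<one> \<zero> (\<ominus> q) \<one>"
      using q by (simp add: sl2_def minus_eq)
    define C where "C = col_op j k \<one> \<zero> (\<ominus> q) \<one> B"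
    have "reach {} (insert j (insert k F)) A B"
      using B(1) by (rule reach_mono) auto
    then have "reach {} (insert j (insert k F)) A C"
      unfolding C_def by (rule reach.col) (use insert.prems sl in auto)
    moreover have "C i k = \<zero>"
      using insert.prems(1,2) insert.hyps B(3) q over_carrierD[OF insert.prems(2)]
      by (auto simp: C_def col_op_def row_op_def l_minus m_comm[of q] l_neg)
    moreover have "C r c = B r c" if "c \<noteq> k" for r c
      using that carr by (auto simp: C_def col_op_def row_op_def over_carrierD)
    moreover have "C i c = \<zero>" if "c \<in> F" for c
      using that calculation(3) B(2) insert.hyps by metis
    ultimately show ?case
      using B(3) by (intro exI[of _ C]) auto
  qed
  then show thesis using that by blast
qed

lemma reach_clear_col:
  assumes "finite F" "i \<notin> F" "over_carrier A" "\<forall>r\<in>F. A i j divides A r j"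
  obtains B where "reach (insert i F) {} A B" "\<forall>r\<in>F. B r j = \<zero>" "\<forall>c. \<forall>r. r \<notin> F \<longrightarrow> B r c = A r c"
proof -
  obtain B where "reach {} (insert i F) (\<lambda>r c. A c r) B" "\<forall>c\<in>F. B j c = \<zero>"
    "\<forall>r. \<forall>c. c \<notin> F \<longrightarrow> B r c = A c r"
    using reach_clear_row[of F i "\<lambda>r c. A c r" j] assms unfolding over_carrier_def by blast
  then show thesis
    using that[of "\<lambda>r c. B c r"] reach_transpose[of _ _ "\<lambda>r c. A c r" B] by blast
qed

section \<open>Pivots and diagonal form over a locally stable Bezout ring\<close>

context
  assumes bez: "bezout_ring R" and ls: "locally_stable R"
begin

text \<open>No pivot is given here: the Hermite property turns entries \<open>(g a, g b)\<close>
  into \<open>(g, 0)\<close>, one column of \<open>F\<close> after the other, and the common factor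
  is collected in column \<open>j\<close>.\<close>

lemma reach_hermite_row:
  assumes "finite F" "j \<notin> F" "over_carrier A"
  obtains B where "reach {} (insert j F) A B" "\<forall>c\<in>F. B i c = \<zero>"
proof -
  have "\<exists>B. reach {} (insert j F) A B \<and> (\<forall>c\<in>F. B i c = \<zero>)"
    using assms
  proof (induction F)
    case empty
    then show ?case using reach.refl by blast
  next
    case (insert k F)
    then obtain B where B: "reach {} (insert j F) A B" "\<forall>c\<in>F. B i c = \<zero>"
      by auto
    have carr: "over_carrier B" using B(1) insert.prems(2) reach_carrier by blast
    obtain g a b x y where g: "g \<in> carrier R" "a \<in> carrier R" "b \<in> carrier R" "x \<in> carrier R"
      "y \<in> carrier R" "B i j = g \<otimes> a" "B i k = g \<otimes> b" "a \<otimes> x \<oplus> b \<otimes> y = \<one>"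
      using hermite[OF bez ls over_carrierD[OF carr, of i j] over_carrierD[OF carr, of i k]] .
    define C where "C = col_op j k x y (\<ominus> b) a B"
    have "reach {} (insert j (insert k F)) A B"
      using B(1) by (rule reach_mono) auto
    then have "reach {} (insert j (insert k F)) A C"
      unfolding C_def by (rule reach.col) (use insert.prems sl2I g in auto)
    moreover have "C i k = \<zero>"
      using insert.prems(1) g(1-7)
      by (auto simp: C_def col_op_def row_op_def l_minus m_lcomm[of a g b] m_comm[of b a] m_lcomm[of b g a] l_neg)
    moreover have "C i c = B i c" if "c \<in> F" for c
      using that insert.prems(1) insert.hyps by (auto simp: C_def col_op_def row_op_def)
    ultimately show ?case
      using B(2) by (intro exI[of _ C]) auto
  qed
  then show thesis using that by blast
qed

text \<open>The pivot becomes a generator \<open>g\<close> of the ideal of all four entries.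
  Divisibility is stated for \<open>A\<close>; it passes to \<open>B\<close> by linear combination
  (\<open>reach_divides\<close>).\<close>

lemma reach_pivot_2x2:
  assumes A: "over_carrier A" and ne: "i \<noteq> k" "j \<noteq> l"
  obtains B where "reach {i, k} {j, l} A B" "\<forall>r\<in>{i, k}. \<forall>c\<in>{j, l}. B i j divides A r c"
proof -
  \<comment> \<open>Column \<open>l\<close> serves as pivot column here, so the zero falls at
    \<open>(k, j)\<close> and the block is upper triangular.\<close>
  obtain A1 where A1: "reach {} {l, j} A A1" "A1 k j = \<zero>"
    using reach_hermite_row[of "{j}" l A k] A ne by auto
  have carr1: "A1 r c \<in> carrier R" for r c
    using reach_carrier[OF A1(1) A] over_carrierD by blast
  obtain g a b c u v w where g: "g \<in> carrier R" "a \<in> carrier R" "b \<in> carrier R" "c \<in> carrier R"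
    "u \<in> carrier R" "v \<in> carrier R" "w \<in> carrier R"
    and eqs: "A1 i j = g \<otimes> a" "A1 i l = g \<otimes> b" "A1 k l = g \<otimes> c"
    and one: "a \<otimes> u \<oplus> b \<otimes> v \<oplus> c \<otimes> w = \<one>"
    using hermite3[OF bez ls carr1[of i j] carr1[of i l] carr1[of k l]] .
  obtain s t where st: "s \<in> carrier R" "t \<in> carrier R" "comaximal R (a \<otimes> s \<oplus> b \<otimes> t) (c \<otimes> t)"
    using triangular_unimodular[OF bez ls g(2-7) one] .
  then obtain p q where pq: "p \<in> carrier R" "q \<in> carrier R"
    and 1: "(a \<otimes> s \<oplus> b \<otimes> t) \<otimes> p \<oplus> (c \<otimes> t) \<otimes> q = \<one>"
    using g by (auto elim: comaximalE)
  \<comment> \<open>The same identity is read in two ways: it completes \<open>(p, q)\<close> to a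
    row operation and \<open>(s, t)\<close> to a column operation.\<close>
  have 2: "(a \<otimes> p) \<otimes> s \<oplus> (b \<otimes> p \<oplus> c \<otimes> q) \<otimes> t = \<one>"
    using g(1-7) st(1,2) pq by (subst 1[symmetric]) (simp add: l_distr r_distr m_ac a_ac)
  define B where "B = col_op j l s t (\<ominus> (b \<otimes> p \<oplus> c \<otimes> q)) (a \<otimes> p)
    (row_op i k p q (\<ominus> (c \<otimes> t)) (a \<otimes> s \<oplus> b \<otimes> t) A1)"
  have r1: "reach {i, k} {j, l} A A1"
    using A1(1) by (rule reach_mono) auto
  then have r2: "reach {i, k} {j, l} A B"
    unfolding B_def
    by (intro reach.col reach.row sl2I) (use ne g st pq 1 2 in auto)
  have "B i j = s \<otimes> (p \<otimes> (g \<otimes> a)) \<oplus> t \<otimes> (p \<otimes> (g \<otimes> b) \<oplus> q \<otimes> (g \<otimes> c))"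
    using ne A1(2) g(1-7) st(1,2) pq by (simp add: B_def col_op_def row_op_def eqs)
  also have "\<dots> = g \<otimes> ((a \<otimes> s \<oplus> b \<otimes> t) \<otimes> p \<oplus> (c \<otimes> t) \<otimes> q)"
    using g(1-7) st(1,2) pq by (simp add: l_distr r_distr m_ac a_ac)
  finally have Bij: "B i j = g"
    using 1 g by simp
  have "\<forall>r\<in>{i, k}. \<forall>c\<in>{j, l}. g divides A1 r c"
    using g A1(2) eqs by (auto simp: factor_def intro: bexI[of _ "\<zero>"])
  \<comment> \<open>Reading the operations backwards carries divisibility by \<open>g\<close> from
    \<open>A1\<close> to \<open>A\<close>.\<close>
  then have "\<forall>r\<in>{i, k}. \<forall>c\<in>{j, l}. g divides A r c"
    using reach_divides[OF reach_sym[OF r1 A] g(1), of "{i, k}" "{j, l}"] by blast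
  with r2 Bij that show thesis by blast
qed

text \<open>Induction over the rows. A new row \<open>k\<close> is cleared up to column
  \<open>j\<close> and one column \<open>l\<close>; the 2 x 2 case for rows \<open>i\<close>,
  \<open>k\<close> and columns \<open>j\<close>, \<open>l\<close> then gives a pivot that divides
  the old one as well as row \<open>k\<close>.\<close>

lemma reach_pivot:
  assumes "finite I" "i \<notin> I" "finite J" "j \<notin> J" "over_carrier A"
  obtains B where "reach (insert i I) (insert j J) A B"
    "\<forall>r\<in>insert i I. \<forall>c\<in>insert j J. B i j divides B r c"
proof -
  have "\<exists>B. reach (insert i I) (insert j J) A B \<and>
      (\<forall>r\<in>insert i I. \<forall>c\<in>insert j J. B i j divides B r c)"
    using assms
  proof (induction I)
    case empty
    obtain B where B: "reach {} (insert j J) A B" "\<forall>c\<in>J. B i c = \<zero>"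
      using reach_hermite_row[OF empty(2,3,4)] by blast
    have "over_carrier B"
      using reach_carrier B(1) empty.prems by blast
    then have "\<forall>r\<in>{i}. \<forall>c\<in>insert j J. B i j divides B r c"
      using B(2) by (auto simp: over_carrierD factor_def intro: bexI[of _ "\<one>"] bexI[of _ "\<zero>"])
    then show ?case
      using reach_mono[OF B(1), of "{i}" "insert j J"] by blast
  next
    case (insert k I)
    then obtain A1 where A1: "reach (insert i I) (insert j J) A A1"
      "\<forall>r\<in>insert i I. \<forall>c\<in>insert j J. A1 i j divides A1 r c"
      by auto
    have carr1: "over_carrier A1"
      using reach_carrier A1(1) insert.prems by blast
    have ne: "i \<noteq> k" "k \<notin> I"
      using insert by auto
    have r1: "reach (insert i (insert k I)) (insert j J) A A1"
      using A1(1) by (rule reach_mono) auto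
    show ?case
    proof (cases "J = {}")
      \<comment> \<open>With a single column there is no room for the 2 x 2 case, and one Hermite
        operation on rows suffices.\<close>
      case True
      obtain g a b x y where g: "g \<in> carrier R" "a \<in> carrier R" "b \<in> carrier R" "x \<in> carrier R"
        "y \<in> carrier R" "A1 i j = g \<otimes> a" "A1 k j = g \<otimes> b" "a \<otimes> x \<oplus> b \<otimes> y = \<one>"
        using hermite[OF bez ls over_carrierD[OF carr1, of i j] over_carrierD[OF carr1, of k j]] .
      define B where "B = row_op i k x y (\<ominus> b) a A1"
      have r2: "reach (insert i (insert k I)) (insert j J) A1 B"
        unfolding B_def by (rule reach.row[OF reach.refl]) (use ne sl2I g in auto)
      have "B i j = g \<otimes> (a \<otimes> x \<oplus> b \<otimes> y)"
        using g(1-7) by (simp add: B_def row_op_def r_distr m_ac)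
      then have Bij: "B i j = g"
        using g by simp
      have g_dvd: "g divides A1 i j" "g divides A1 k j"
        unfolding g(6,7) using g(1-3) by auto
      have "g divides A1 r j" if "r \<in> insert i I" for r
        using divides_trans[OF g_dvd(1) _ g(1)] A1(2) that by blast
      with g_dvd(2) True have "\<forall>r\<in>insert i (insert k I). \<forall>c\<in>insert j J. g divides A1 r c"
        by auto
      then have "\<forall>r\<in>insert i (insert k I). \<forall>c\<in>insert j J. g divides B r c"
        by (intro reach_divides[OF r2]) (use g in auto)
      then show ?thesis
        using reach_trans[OF r1 r2] Bij by blast
    next
      case False
      then obtain l where l: "l \<in> J" by blast
      have jl: "j \<noteq> l" using l insert.prems by auto
      \<comment> \<open>Only columns of \<open>J\<close> are combined, so the old pivot in column
        \<open>j\<close> keeps its value and, by linear combination, still divides the earlier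
        rows.\<close>
      obtain A2 where A2: "reach {} (insert l (J - {l})) A1 A2" "\<forall>c\<in>J - {l}. A2 k c = \<zero>"
        using reach_hermite_row[of "J - {l}" l A1 k] insert.prems carr1 by auto
      have A2': "reach {} J A1 A2"
        using A2(1) l by (simp add: insert_absorb)
      have carr2: "over_carrier A2"
        using reach_carrier A2(1) carr1 by blast
      have "\<forall>r\<in>insert i I. \<forall>c\<in>insert j J. A1 i j divides A2 r c"
        by (intro reach_divides[OF A2']) (use A1(2) carr1 over_carrierD in auto)
      moreover have "A2 i j = A1 i j"
        using reach_unchanged[OF A2'] insert.prems by auto
      ultimately have d2: "\<forall>r\<in>insert i I. \<forall>c\<in>insert j J. A2 i j divides A2 r c"
        by simp
      obtain B where B: "reach {i, k} {j, l} A2 B" "\<forall>r\<in>{i, k}. \<forall>c\<in>{j, l}. B i j divides A2 r c"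
        using reach_pivot_2x2[OF carr2 ne(1) jl] .
      have r2: "reach (insert i (insert k I)) (insert j J) A1 A2"
        using A2' by (rule reach_mono) auto
      have r3: "reach (insert i (insert k I)) (insert j J) A2 B"
        using B(1) by (rule reach_mono) (use l in auto)
      have Bij: "B i j \<in> carrier R"
        using reach_carrier[OF B(1) carr2] over_carrierD by blast
      have "B i j divides A2 r c" if r: "r \<in> insert i (insert k I)" and c: "c \<in> insert j J" for r c
      proof (cases "r = k")
        case True
        show ?thesis
        proof (cases "c \<in> {j, l}")
          case True
          then show ?thesis using B(2) \<open>r = k\<close> by blast
        next
          case False
          then have "A2 r c = \<zero>" using A2(2) c \<open>r = k\<close> by blast
          then show ?thesis using Bij by (auto simp: factor_def intro: bexI[of _ "\<zero>"])
        qed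
      next
        case False
        then have "A2 i j divides A2 r c" using d2 r c by auto
        moreover have "B i j divides A2 i j" using B(2) by blast
        ultimately show ?thesis using divides_trans Bij by blast
      qed
      then have "\<forall>r\<in>insert i (insert k I). \<forall>c\<in>insert j J. B i j divides B r c"
        by (intro reach_divides[OF r3]) (use Bij in auto)
      then show ?thesis
        using reach_trans[OF r1 reach_trans[OF r2 r3]] by blast
    qed
  qed
  then show thesis using that by blast
qed

text \<open>Each diagonal entry is required to divide the whole remaining block, because this
  survives further operations on the block. Divisibility of the next diagonal entry alone would
  not.\<close>

lemma reach_diagonal:
  assumes A: "over_carrier A" and "k \<le> min m n"
  shows "\<exists>B. reach {..<m} {..<n} A B \<and>
    (\<forall>r<m. \<forall>c<n. r \<noteq> c \<and> (r < k \<or> c < k) \<longrightarrow> B r c = \<zero>) \<and>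
    (\<forall>i<k. \<forall>r\<in>{i..<m}. \<forall>c\<in>{i..<n}. B i i divides B r c)"
  using assms(2)
proof (induction k)
  case 0
  then show ?case using reach.refl by blast
next
  case (Suc k)
  then have k: "k < m" "k < n" by auto
  from Suc obtain B where B: "reach {..<m} {..<n} A B"
    and zero: "\<And>r c. r < m \<Longrightarrow> c < n \<Longrightarrow> r \<noteq> c \<Longrightarrow> r < k \<or> c < k \<Longrightarrow> B r c = \<zero>"
    and dvd: "\<And>i. i < k \<Longrightarrow> \<forall>r\<in>{i..<m}. \<forall>c\<in>{i..<n}. B i i divides B r c"
    by auto
  have ins: "insert k {Suc k..<m} = {k..<m}" "insert k {Suc k..<n} = {k..<n}"
    using k by auto
  have cB: "over_carrier B"
    using reach_carrier B A by blast
  obtain C1 where C1: "reach {k..<m} {k..<n} B C1"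
    and d1: "\<forall>r\<in>{k..<m}. \<forall>c\<in>{k..<n}. C1 k k divides C1 r c"
    using reach_pivot[of "{Suc k..<m}" k "{Suc k..<n}" k B] cB unfolding ins by auto
  have c1: "over_carrier C1"
    using reach_carrier C1 cB by blast
  \<comment> \<open>Clearing the row leaves column \<open>k\<close> unchanged, so the pivot still
    divides it. Clearing the column then leaves row \<open>k\<close> unchanged together with its
    zeros.\<close>
  obtain C2 where C2: "reach {} {k..<n} C1 C2" "\<forall>c\<in>{Suc k..<n}. C2 k c = \<zero>"
    "\<forall>r. \<forall>c. c \<notin> {Suc k..<n} \<longrightarrow> C2 r c = C1 r c"
    using reach_clear_row[of "{Suc k..<n}" k C1 k] c1 d1 k unfolding ins by auto
  have c2: "over_carrier C2"
    using reach_carrier C2(1) c1 by blast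
  have "\<forall>r\<in>{Suc k..<m}. C2 k k divides C2 r k"
    using d1 C2(3) k by simp
  then obtain C where C: "reach {k..<m} {} C2 C" "\<forall>r\<in>{Suc k..<m}. C r k = \<zero>"
    "\<forall>c. \<forall>r. r \<notin> {Suc k..<m} \<longrightarrow> C r c = C2 r c"
    using reach_clear_col[of "{Suc k..<m}" k C2 k] c2 unfolding ins by auto
  have r2: "reach {k..<m} {k..<n} C1 C2" and r3: "reach {k..<m} {k..<n} C2 C"
    using reach_mono[OF C2(1), of "{k..<m}" "{k..<n}"] reach_mono[OF C(1), of "{k..<m}" "{k..<n}"]
    by auto
  have r: "reach {k..<m} {k..<n} B C"
    using reach_trans[OF C1 reach_trans[OF r2 r3]] .
  have "\<forall>r\<in>{k..<m}. \<forall>c\<in>{k..<n}. C1 k k divides C r c"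
    by (intro reach_divides[OF reach_trans[OF r2 r3]]) (use d1 c1 over_carrierD in auto)
  moreover have "C k k = C1 k k"
    using C(3) C2(3) by simp
  ultimately have dk: "\<forall>r\<in>{k..<m}. \<forall>c\<in>{k..<n}. C k k divides C r c"
    by simp
  have "C r c = \<zero>" if rc: "r < m" "c < n" "r \<noteq> c" "r < Suc k \<or> c < Suc k" for r c
  proof -
    consider "r < k" "c < k" | "r < k" "c \<ge> k" | "r \<ge> k" "c < k" | "r = k" "c > k" | "c = k" "r > k"
      using rc by linarith
    then show ?thesis
    proof cases
      case 1
      then show ?thesis using reach_unchanged[OF r] zero rc by auto
    next
      case 2
      \<comment> \<open>Row \<open>r\<close> is not operated on as a row, but column operations
        combine its entries from column \<open>k\<close> on. All of these vanish, so they stay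
        zero.\<close>
      have "\<forall>r\<in>{r}. \<forall>c\<in>{k..<n}. \<zero> divides C r c"
        by (intro reach_divides[OF r]) (use 2 rc zero in \<open>auto simp: zero_divides_iff\<close>)
      then show ?thesis using 2 rc by (simp add: zero_divides_iff)
    next
      case 3
      have "\<forall>r\<in>{k..<m}. \<forall>c\<in>{c}. \<zero> divides C r c"
        by (intro reach_divides[OF r]) (use 3 rc zero in \<open>auto simp: zero_divides_iff\<close>)
      then show ?thesis using 3 rc by (simp add: zero_divides_iff)
    next
      case 4
      then show ?thesis using C(3) C2(2) rc by simp
    next
      case 5
      then show ?thesis using C(2) rc by simp
    qed
  qed
  moreover have "\<forall>r\<in>{i..<m}. \<forall>c\<in>{i..<n}. C i i divides C r c" if i: "i < Suc k" for i
  proof (cases "i = k")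
    case True
    then show ?thesis using dk by simp
  next
    case False
    then have ik: "i < k" using i by simp
    have "C i i = B i i"
      using reach_unchanged[OF r] ik by simp
    \<comment> \<open>The block starting at \<open>i\<close> contains all rows and columns that were
      operated on.\<close>
    moreover have "\<forall>r\<in>{i..<m}. \<forall>c\<in>{i..<n}. B i i divides C r c"
      by (intro reach_divides[OF r]) (use ik dvd cB over_carrierD in auto)
    ultimately show ?thesis by simp
  qed
  moreover have "reach {..<m} {..<n} A C"
    using B by (rule reach_trans) (rule reach_mono[OF r], auto)
  ultimately show ?case by blast
qed

end

section \<open>Realization by invertible matrices\<close>

definition fun_mult :: "nat \<Rightarrow> (nat \<Rightarrow> nat \<Rightarrow> 'a) \<Rightarrow> (nat \<Rightarrow> nat \<Rightarrow> 'a) \<Rightarrow> nat \<Rightarrow> nat \<Rightarrow> 'a" where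
  "fun_mult n A B = (\<lambda>r c. \<Oplus>l\<in>{0..<n}. A r l \<otimes> B l c)"

definition fun_one :: "nat \<Rightarrow> nat \<Rightarrow> 'a" where
  "fun_one = (\<lambda>r c. if r = c then \<one> else \<zero>)"

text \<open>The identities are required only on the \<open>n\<close> by \<open>n\<close> block, as
  values outside it carry no information.\<close>

definition inv_pair :: "nat \<Rightarrow> (nat \<Rightarrow> nat \<Rightarrow> 'a) \<Rightarrow> (nat \<Rightarrow> nat \<Rightarrow> 'a) \<Rightarrow> bool" where
  "inv_pair n P P' \<longleftrightarrow> over_carrier P \<and> over_carrier P' \<and>
     (\<forall>r<n. \<forall>c<n. fun_mult n P P' r c = fun_one r c \<and> fun_mult n P' P r c = fun_one r c)"

section \<open>Products of index functions and their compatibility with the operations\<close>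

lemma over_carrier_fun_mult: "over_carrier A \<Longrightarrow> over_carrier B \<Longrightarrow> over_carrier (fun_mult n A B)"
  by (auto simp: over_carrier_def fun_mult_def intro!: finsum_closed)

lemma over_carrier_fun_one: "over_carrier fun_one"
  by (auto simp: over_carrier_def fun_one_def)

lemma fun_mult_cong:
  assumes "\<And>l. l < n \<Longrightarrow> A r l = A' r l" "\<And>l. l < n \<Longrightarrow> B l c = B' l c" "over_carrier A'" "over_carrier B'"
  shows "fun_mult n A B r c = fun_mult n A' B' r c"
  unfolding fun_mult_def by (rule finsum_cong') (use assms in \<open>auto simp: over_carrierD\<close>)

lemma finsum_swap:
  assumes "finite S" "finite T" "\<And>i j. i \<in> S \<Longrightarrow> j \<in> T \<Longrightarrow> f i j \<in> carrier R"
  shows "(\<Oplus>i\<in>S. \<Oplus>j\<in>T. f i j) = (\<Oplus>j\<in>T. \<Oplus>i\<in>S. f i j)"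
  using assms(1,3)
proof (induction S)
  case empty
  then show ?case by (simp add: finsum_zero)
next
  case (insert s S)
  have "(\<Oplus>j\<in>T. \<Oplus>i\<in>insert s S. f i j) = (\<Oplus>j\<in>T. f s j \<oplus> (\<Oplus>i\<in>S. f i j))"
    by (rule finsum_cong') (use insert in \<open>auto intro!: finsum_closed\<close>)
  also have "\<dots> = (\<Oplus>j\<in>T. f s j) \<oplus> (\<Oplus>j\<in>T. \<Oplus>i\<in>S. f i j)"
    by (rule finsum_addf) (use insert in \<open>auto intro!: finsum_closed\<close>)
  also have "\<dots> = (\<Oplus>i\<in>insert s S. \<Oplus>j\<in>T. f i j)"
    using insert by (subst finsum_insert) (auto intro!: finsum_closed)
  finally show ?case ..
qed

lemma fun_mult_assoc:
  assumes "over_carrier A" "over_carrier B" "over_carrier C"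
  shows "fun_mult n (fun_mult k A B) C = fun_mult k A (fun_mult n B C)"
proof (intro ext)
  fix r c
  note cl = assms[THEN over_carrierD]
  have "fun_mult n (fun_mult k A B) C r c = (\<Oplus>l\<in>{0..<n}. \<Oplus>j\<in>{0..<k}. A r j \<otimes> B j l \<otimes> C l c)"
    unfolding fun_mult_def using cl
    by (intro finsum_cong') (auto intro!: finsum_closed finsum_ldistr)
  also have "\<dots> = (\<Oplus>j\<in>{0..<k}. \<Oplus>l\<in>{0..<n}. A r j \<otimes> B j l \<otimes> C l c)"
    by (rule finsum_swap) (use cl in auto)
  also have "\<dots> = fun_mult k A (fun_mult n B C) r c"
    unfolding fun_mult_def using cl
    by (intro finsum_cong') (auto intro!: finsum_closed simp: finsum_rdistr m_assoc)
  finally show "fun_mult n (fun_mult k A B) C r c = fun_mult k A (fun_mult n B C) r c" .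
qed

lemma fun_mult_transpose:
  assumes "over_carrier A" "over_carrier B"
  shows "fun_mult n (\<lambda>r c. B c r) (\<lambda>r c. A c r) = (\<lambda>r c. fun_mult n A B c r)"
  using assms by (auto simp: fun_mult_def fun_eq_iff m_comm over_carrierD)

lemma fun_mult_fun_one_left:
  assumes "over_carrier A" "r < n"
  shows "fun_mult n fun_one A r c = A r c"
proof -
  have "fun_mult n fun_one A r c = (\<Oplus>l\<in>{0..<n}. if r = l then A l c else \<zero>)"
    unfolding fun_mult_def fun_one_def by (rule finsum_cong') (use assms in \<open>auto simp: over_carrierD\<close>)
  also have "\<dots> = A r c"
    by (rule finsum_singleton) (use assms in \<open>auto simp: over_carrierD\<close>)
  finally show ?thesis .
qed

lemma transpose_fun_one: "(\<lambda>r c. fun_one c r) = fun_one"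
  by (auto simp: fun_one_def fun_eq_iff)

lemma fun_mult_fun_one_right:
  assumes "over_carrier A" "c < n"
  shows "fun_mult n A fun_one r c = A r c"
proof -
  have "over_carrier (\<lambda>r c. A c r)"
    using assms by (simp add: over_carrier_def)
  from fun_mult_fun_one_left[OF this assms(2)] show ?thesis
    using fun_cong[OF fun_cong[OF fun_mult_transpose[OF assms(1) over_carrier_fun_one]], of n c r]
    unfolding transpose_fun_one by simp
qed

text \<open>A row operation combines rows of the left factor only. So an operation on
  \<open>P A Q\<close> can be moved into \<open>P\<close> without writing down elementary
  matrices.\<close>

lemma row_op_fun_mult:
  assumes "over_carrier A" "over_carrier B" "sl2 x y z w"
  shows "fun_mult n (row_op i k x y z w A) B = row_op i k x y z w (fun_mult n A B)"
proof (intro ext)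
  fix r c
  note cl = over_carrierD[OF assms(1)] over_carrierD[OF assms(2)]
  have "(\<Oplus>l\<in>{0..<n}. (p \<otimes> A i l \<oplus> q \<otimes> A k l) \<otimes> B l c) =
      p \<otimes> (\<Oplus>l\<in>{0..<n}. A i l \<otimes> B l c) \<oplus> q \<otimes> (\<Oplus>l\<in>{0..<n}. A k l \<otimes> B l c)"
    if pq: "p \<in> carrier R" "q \<in> carrier R" for p q
  proof -
    have "(\<Oplus>l\<in>{0..<n}. (p \<otimes> A i l \<oplus> q \<otimes> A k l) \<otimes> B l c) =
        (\<Oplus>l\<in>{0..<n}. p \<otimes> (A i l \<otimes> B l c) \<oplus> q \<otimes> (A k l \<otimes> B l c))"
      by (rule finsum_cong') (use cl pq in \<open>auto simp: l_distr m_assoc\<close>)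
    also have "\<dots> = (\<Oplus>l\<in>{0..<n}. p \<otimes> (A i l \<otimes> B l c)) \<oplus> (\<Oplus>l\<in>{0..<n}. q \<otimes> (A k l \<otimes> B l c))"
      by (rule finsum_addf) (use cl pq in auto)
    finally show ?thesis
      using cl pq by (simp add: finsum_rdistr)
  qed
  then show "fun_mult n (row_op i k x y z w A) B r c = row_op i k x y z w (fun_mult n A B) r c"
    using assms(3) by (auto simp: fun_mult_def row_op_def sl2_def)
qed

lemma col_op_fun_mult:
  assumes "over_carrier A" "over_carrier B" "sl2 x y z w"
  shows "fun_mult n A (col_op j l x y z w B) = col_op j l x y z w (fun_mult n A B)"
proof -
  have t: "over_carrier (\<lambda>r c. A c r)" "over_carrier (\<lambda>r c. B c r)"
    using assms by (simp_all add: over_carrier_def)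
  have "fun_mult n A (col_op j l x y z w B) =
      (\<lambda>r c. fun_mult n (row_op j l x y z w (\<lambda>r c. B c r)) (\<lambda>r c. A c r) c r)"
    using fun_mult_transpose[OF over_carrier_row_op[OF t(2) assms(3)] t(1)] by (simp add: col_op_def)
  also have "\<dots> = col_op j l x y z w (fun_mult n A B)"
    unfolding row_op_fun_mult[OF t(2,1) assms(3)] fun_mult_transpose[OF assms(1,2)] by (simp add: col_op_def)
  finally show ?thesis .
qed

lemma inv_pair_transpose:
  assumes "inv_pair n P P'"
  shows "inv_pair n (\<lambda>r c. P c r) (\<lambda>r c. P' c r)"
proof -
  have c: "over_carrier P" "over_carrier P'"
    using assms by (auto simp: inv_pair_def)
  have sym: "\<forall>r<n. \<forall>c<n. fun_one c r = fun_one r c"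
    by (simp add: fun_one_def)
  have "\<forall>r<n. \<forall>c<n. fun_mult n P P' c r = fun_one r c \<and> fun_mult n P' P c r = fun_one r c"
    using assms sym unfolding inv_pair_def by metis
  moreover have "over_carrier (\<lambda>r c. P c r)" "over_carrier (\<lambda>r c. P' c r)"
    using c by (simp_all add: over_carrier_def)
  ultimately show ?thesis
    unfolding inv_pair_def fun_mult_transpose[OF c] fun_mult_transpose[OF c(2,1)] by blast
qed

lemma inv_pair_fun_one: "inv_pair n fun_one fun_one"
  by (simp add: inv_pair_def over_carrier_fun_one fun_mult_fun_one_left)

text \<open>The new inverse is \<open>P' E\<close>, where \<open>E\<close> is the matrix of the
  inverse operation, obtained by applying that operation to the identity.\<close>

lemma inv_pair_row_op:
  assumes PP': "inv_pair n P P'" and ik: "i < n" "k < n" "i \<noteq> k" and sl: "sl2 x y z w"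
  shows "\<exists>P''. inv_pair n (row_op i k x y z w P) P''"
proof -
  have c: "over_carrier P" "over_carrier P'"
    and inv: "\<And>r c. r < n \<Longrightarrow> c < n \<Longrightarrow> fun_mult n P P' r c = fun_one r c"
      "\<And>r c. r < n \<Longrightarrow> c < n \<Longrightarrow> fun_mult n P' P r c = fun_one r c"
    using PP' by (auto simp: inv_pair_def)
  define E where "E = row_op i k w (\<ominus> y) (\<ominus> z) x fun_one"
  define Q where "Q = row_op i k x y z w P"
  note sl' = sl2_inverse[OF sl]
  have cE: "over_carrier E" and cQ: "over_carrier Q"
    unfolding E_def Q_def by (auto intro: over_carrier_row_op over_carrier_fun_one c sl sl')
  have rE: "row_op i k x y z w E = fun_one"
    using row_op_inverse[OF over_carrier_fun_one ik(3) sl'] sl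
    by (simp add: E_def sl2_def minus_minus)
  have XE: "fun_mult n (fun_mult n P P') E r c = E r c" if "r < n" for r c
    using fun_mult_cong[of n "fun_mult n P P'" r fun_one E c E] fun_mult_fun_one_left[OF cE that] inv that
      over_carrier_fun_one cE by simp
  have "row_op i k x y z w (fun_mult n (fun_mult n P P') E) r c = fun_one r c" if "r < n" for r c
  proof -
    have "row_op i k x y z w (fun_mult n (fun_mult n P P') E) r c = row_op i k x y z w E r c"
      using XE that ik(1,2) by (simp add: row_op_def)
    then show ?thesis using rE by simp
  qed
  \<comment> \<open>By associativity \<open>Q P' E\<close> is the operation applied to
    \<open>P P' E\<close>, that is to \<open>E\<close>, and this gives the identity.\<close>
  then have 1: "fun_mult n Q (fun_mult n P' E) r c = fun_one r c" if "r < n" for r c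
    using that unfolding fun_mult_assoc[OF cQ c(2) cE, symmetric] unfolding Q_def row_op_fun_mult[OF c sl]
      row_op_fun_mult[OF over_carrier_fun_mult[OF c] cE sl] .
  \<comment> \<open>Conversely \<open>E Q\<close> is the inverse operation applied to
    \<open>Q\<close>, which restores \<open>P\<close>.\<close>
  have "fun_mult n E Q r c = P r c" if "r < n" for r c
  proof -
    have "fun_mult n E Q r c = row_op i k w (\<ominus> y) (\<ominus> z) x (fun_mult n fun_one Q) r c"
      unfolding E_def row_op_fun_mult[OF over_carrier_fun_one cQ sl'] ..
    also have "\<dots> = row_op i k w (\<ominus> y) (\<ominus> z) x Q r c"
      using that ik(1,2) fun_mult_fun_one_left[OF cQ] by (simp add: row_op_def)
    finally show ?thesis
      unfolding Q_def row_op_inverse[OF c(1) ik(3) sl] .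
  qed
  then have 2: "fun_mult n (fun_mult n P' E) Q r c = fun_one r c" if "r < n" "c < n" for r c
    using that inv(2) fun_mult_cong[of n P' r P' "fun_mult n E Q" c P] c
    unfolding fun_mult_assoc[OF c(2) cE cQ] by simp
  show ?thesis
    unfolding Q_def[symmetric] using 1 2 cQ over_carrier_fun_mult[OF c(2) cE]
    unfolding inv_pair_def by (intro exI[of _ "fun_mult n P' E"]) simp
qed

lemma inv_pair_col_op:
  assumes "inv_pair n Q Q'" "j < n" "l < n" "j \<noteq> l" "sl2 x y z w"
  shows "\<exists>Q''. inv_pair n (col_op j l x y z w Q) Q''"
proof -
  obtain P'' where "inv_pair n (row_op j l x y z w (\<lambda>r c. Q c r)) P''"
    using inv_pair_row_op[OF inv_pair_transpose[OF assms(1)] assms(2-5)] by blast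
  from inv_pair_transpose[OF this] show ?thesis
    by (auto simp: col_op_def)
qed

lemma reach_factorization:
  assumes "reach {..<m} {..<n} A B" "over_carrier A"
  shows "\<exists>P P' Q Q'. inv_pair m P P' \<and> inv_pair n Q Q' \<and>
    (\<forall>r<m. \<forall>c<n. fun_mult n (fun_mult m P A) Q r c = B r c)"
  using assms
proof induction
  case refl
  have "fun_mult n (fun_mult m fun_one A) fun_one r c = A r c" if "r < m" "c < n" for r c
    using that refl by (simp add: fun_mult_fun_one_right fun_mult_fun_one_left over_carrier_fun_mult over_carrier_fun_one)
  then show ?case using inv_pair_fun_one by blast
next
  case (row B i k x y z w)
  then obtain P P' Q Q' where PQ: "inv_pair m P P'" "inv_pair n Q Q'"
    and eq: "\<And>r c. r < m \<Longrightarrow> c < n \<Longrightarrow> fun_mult n (fun_mult m P A) Q r c = B r c" by blast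
  have c: "over_carrier P" "over_carrier Q"
    using PQ by (auto simp: inv_pair_def)
  obtain P'' where "inv_pair m (row_op i k x y z w P) P''"
    using inv_pair_row_op[OF PQ(1) _ _ row(4,5)] row(2,3) by auto
  moreover have "fun_mult n (fun_mult m (row_op i k x y z w P) A) Q r c = row_op i k x y z w B r c"
    if "r < m" "c < n" for r c
    using that eq row(2,3)
    unfolding row_op_fun_mult[OF c(1) row(7,5)] row_op_fun_mult[OF over_carrier_fun_mult[OF c(1) row(7)] c(2) row(5)]
    by (auto simp: row_op_def)
  ultimately show ?case using PQ(2) by blast
next
  case (col B j l x y z w)
  then obtain P P' Q Q' where PQ: "inv_pair m P P'" "inv_pair n Q Q'"
    and eq: "\<And>r c. r < m \<Longrightarrow> c < n \<Longrightarrow> fun_mult n (fun_mult m P A) Q r c = B r c" by blast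
  have c: "over_carrier P" "over_carrier Q"
    using PQ by (auto simp: inv_pair_def)
  obtain Q'' where "inv_pair n (col_op j l x y z w Q) Q''"
    using inv_pair_col_op[OF PQ(2) _ _ col(4,5)] col(2,3) by auto
  moreover have "fun_mult n (fun_mult m P A) (col_op j l x y z w Q) r c = col_op j l x y z w B r c"
    if "r < m" "c < n" for r c
    using that eq col(2,3)
    unfolding col_op_fun_mult[OF over_carrier_fun_mult[OF c(1) col(7)] c(2) col(5)]
    by (auto simp: col_op_def row_op_def)
  ultimately show ?case using PQ(1) by blast
qed

section \<open>Passage between index functions and matrices\<close>

lemma mats_over_mat: "over_carrier A \<Longrightarrow> mat m n (case_prod A) \<in> mats_over R m n"
  by (auto simp: mats_over_def elements_mat_def over_carrierD)

lemma mats_overE: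
  assumes "M \<in> mats_over R m n"
  obtains A where "over_carrier A" "M = mat m n (case_prod A)"
proof
  have "M $$ (r, c) \<in> carrier R" if "r < m" "c < n" for r c
    using assms elements_matI[of M m n r c, OF _ that] unfolding mats_over_def by blast
  \<comment> \<open>Entries outside the block are set to zero, since \<open>over_carrier\<close>
    asks for values in \<open>R\<close> at all indices.\<close>
  then show "over_carrier (\<lambda>r c. if r < m \<and> c < n then M $$ (r, c) else \<zero>)"
    by (simp add: over_carrier_def)
  show "M = mat m n (case_prod (\<lambda>r c. if r < m \<and> c < n then M $$ (r, c) else \<zero>))"
    using assms by (auto simp: mats_over_def)
qed

lemma mult_over_mat:
  assumes "over_carrier A" "over_carrier B"
  shows "mult_over R (mat m k (case_prod A)) (mat k n (case_prod B)) = mat m n (case_prod (fun_mult k A B))"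
proof (rule eq_matI)
  fix i j assume ij: "i < dim_row (mat m n (case_prod (fun_mult k A B)))"
    "j < dim_col (mat m n (case_prod (fun_mult k A B)))"
  have "(\<Oplus>l\<in>{0..<k}. mat m k (case_prod A) $$ (i, l) \<otimes> mat k n (case_prod B) $$ (l, j)) = fun_mult k A B i j"
    unfolding fun_mult_def by (rule finsum_cong') (use ij assms in \<open>auto simp: over_carrierD\<close>)
  with ij show "mult_over R (mat m k (case_prod A)) (mat k n (case_prod B)) $$ (i, j) =
      mat m n (case_prod (fun_mult k A B)) $$ (i, j)"
    by (simp add: mult_over_def)
qed (auto simp: mult_over_def)

lemma one_over_fun_one: "one_over R n = mat n n (case_prod fun_one)"
  by (auto simp: one_over_def fun_one_def)

lemma mat_case_prod_eq_iff:
  "mat m n (case_prod A) = mat m n (case_prod B) \<longleftrightarrow> (\<forall>r<m. \<forall>c<n. A r c = B r c)"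
proof
  assume eq: "mat m n (case_prod A) = mat m n (case_prod B)"
  show "\<forall>r<m. \<forall>c<n. A r c = B r c"
  proof (intro allI impI)
    fix r c assume "r < m" "c < n"
    then show "A r c = B r c"
      using arg_cong[OF eq, of "\<lambda>M. M $$ (r, c)"] by simp
  qed
qed auto

lemma inv_pair_invertible:
  assumes "inv_pair n P P'"
  shows "mat n n (case_prod P) \<in> invertible_mats_over R n"
  using assms unfolding invertible_mats_over_def
  by (auto simp: inv_pair_def mult_over_mat one_over_fun_one mat_case_prod_eq_iff
      intro!: mats_over_mat bexI[of _ "mat n n (case_prod P')"])

lemma invertible_mats_overE:
  assumes "M \<in> invertible_mats_over R n"
  obtains P P' where "inv_pair n P P'" "M = mat n n (case_prod P)"
proof -
  from assms obtain N where M: "M \<in> mats_over R n n" and N: "N \<in> mats_over R n n"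
    and eq: "mult_over R M N = one_over R n" "mult_over R N M = one_over R n"
    by (auto simp: invertible_mats_over_def)
  obtain P where P: "over_carrier P" "M = mat n n (case_prod P)"
    using M by (rule mats_overE)
  obtain P' where P': "over_carrier P'" "N = mat n n (case_prod P')"
    using N by (rule mats_overE)
  have "inv_pair n P P'"
    using eq P P' by (auto simp: inv_pair_def mult_over_mat one_over_fun_one mat_case_prod_eq_iff)
  with that P show thesis by blast
qed

lemma bezout_imp_elementary_divisor:
  assumes bez: "bezout_ring R" and ls: "locally_stable R"
  shows "elementary_divisor_ring R"
  unfolding elementary_divisor_ring_def
proof (intro allI ballI)
  fix m n M assume "M \<in> mats_over R m n"
  then obtain A where A: "over_carrier A" "M = mat m n (case_prod A)"
    by (rule mats_overE)
  obtain D where D: "reach {..<m} {..<n} A D"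
    and zero: "\<And>r c. r < m \<Longrightarrow> c < n \<Longrightarrow> r \<noteq> c \<Longrightarrow> D r c = \<zero>"
    and dvd: "\<And>i r c. i \<le> r \<Longrightarrow> r < m \<Longrightarrow> i \<le> c \<Longrightarrow> c < n \<Longrightarrow> D i i divides D r c"
  proof -
    obtain D where D: "reach {..<m} {..<n} A D"
      "\<forall>r<m. \<forall>c<n. r \<noteq> c \<and> (r < min m n \<or> c < min m n) \<longrightarrow> D r c = \<zero>"
      "\<forall>i<min m n. \<forall>r\<in>{i..<m}. \<forall>c\<in>{i..<n}. D i i divides D r c"
      using reach_diagonal[OF bez ls A(1), of "min m n" m n] by auto
    \<comment> \<open>The smaller of two distinct indices \<open>r < m\<close> and
      \<open>c < n\<close> lies below both bounds, so all off-diagonal entries are covered.\<close>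
    have "r < min m n \<or> c < min m n" if "r < m" "c < n" "r \<noteq> c" for r c
      using that by linarith
    with D show thesis
      by (intro that[of D]) auto
  qed
  obtain P P' Q Q' where PQ: "inv_pair m P P'" "inv_pair n Q Q'"
    and eq: "\<forall>r<m. \<forall>c<n. fun_mult n (fun_mult m P A) Q r c = D r c"
    using reach_factorization[OF D A(1)] by blast
  have c: "over_carrier P" "over_carrier Q"
    using PQ by (auto simp: inv_pair_def)
  have "mult_over R (mult_over R (mat m m (case_prod P)) M) (mat n n (case_prod Q)) = mat m n (case_prod D)"
    using eq A c by (simp add: mult_over_mat over_carrier_fun_mult mat_case_prod_eq_iff)
  then show "admits_diagonal_reduction R M"
    unfolding admits_diagonal_reduction_def Let_def
    using inv_pair_invertible[OF PQ(1)] inv_pair_invertible[OF PQ(2)] A(2) zero dvd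
    by (intro bexI[of _ "mat m m (case_prod P)"] bexI[of _ "mat n n (case_prod Q)"]) auto
qed

section \<open>Elementary divisor rings are Bezout\<close>

lemma ideal_finsum_closed:
  assumes "ideal I R" "finite S" "\<And>s. s \<in> S \<Longrightarrow> f s \<in> I"
  shows "(\<Oplus>s\<in>S. f s) \<in> I"
  using assms(2,3)
proof (induction S)
  case empty
  then show ?case
    using assms(1) by (simp add: additive_subgroup.zero_closed ideal.axioms(1))
next
  case (insert s S)
  have "f t \<in> carrier R" if "t \<in> insert s S" for t
    using insert.prems[OF that] ideal.Icarr[OF assms(1)] by blast
  then show ?case
    using insert assms(1)
    by (subst finsum_insert) (auto simp: additive_subgroup.a_closed ideal.axioms(1))
qed

lemma fun_mult_ideal_left:
  assumes "ideal I R" "\<And>l. l < n \<Longrightarrow> A r l \<in> I" "over_carrier B"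
  shows "fun_mult n A B r c \<in> I"
  unfolding fun_mult_def using assms
  by (intro ideal_finsum_closed) (auto intro: ideal.I_r_closed over_carrierD)

lemma fun_mult_ideal_right:
  assumes "ideal I R" "\<And>l. l < n \<Longrightarrow> B l c \<in> I" "over_carrier A"
  shows "fun_mult n A B r c \<in> I"
  unfolding fun_mult_def using assms
  by (intro ideal_finsum_closed) (auto intro: ideal.I_l_closed over_carrierD)

text \<open>A diagonal reduction of the row of generators has at most one nonzero entry. It lies in
  the ideal of the generators, and multiplying back by the inverses puts each generator into its
  principal ideal.\<close>

lemma elementary_divisor_imp_bezout:
  assumes "elementary_divisor_ring R"
  shows "bezout_ring R"
  unfolding bezout_ring_def
proof (intro allI impI)
  fix S assume S: "finite S \<and> S \<subseteq> carrier R"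
  then obtain xs where xs: "set xs = S"
    using finite_list by blast
  \<comment> \<open>A zero column is appended to the generators, so that the entry
    \<open>(0, 0)\<close> exists also for empty \<open>S\<close>.\<close>
  define n where "n = Suc (length xs)"
  define A where "A = (\<lambda>(r::nat) c. if c < length xs then xs ! c else \<zero>)"
  have A: "over_carrier A"
    using S xs by (auto simp: over_carrier_def A_def)
  have "admits_diagonal_reduction R (mat 1 n (case_prod A))"
    using assms mats_over_mat[OF A] unfolding elementary_divisor_ring_def by blast
  then obtain M N where M: "M \<in> invertible_mats_over R 1" and N: "N \<in> invertible_mats_over R n"
    and diag: "\<forall>j<n. j \<noteq> 0 \<longrightarrow> mult_over R (mult_over R M (mat 1 n (case_prod A))) N $$ (0, j) = \<zero>"
    unfolding admits_diagonal_reduction_def Let_def by auto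
  obtain P P' where P: "inv_pair 1 P P'" "M = mat 1 1 (case_prod P)"
    using M by (rule invertible_mats_overE)
  obtain Q Q' where Q: "inv_pair n Q Q'" "N = mat n n (case_prod Q)"
    using N by (rule invertible_mats_overE)
  have c: "over_carrier P" "over_carrier P'" "over_carrier Q" "over_carrier Q'"
    using P Q by (auto simp: inv_pair_def)
  define D where "D = fun_mult n (fun_mult 1 P A) Q"
  have D: "over_carrier D"
    unfolding D_def by (intro over_carrier_fun_mult A c)
  have zero: "D 0 j = \<zero>" if "j < n" "j \<noteq> 0" for j
    using diag that unfolding P(2) Q(2) mult_over_mat[OF c(1) A]
      mult_over_mat[OF over_carrier_fun_mult[OF c(1) A] c(3)] by (simp add: D_def)
  have idS: "ideal (Idl S) R"
    using S genideal_ideal by blast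
  have A_in: "A r c \<in> Idl S" for r c
    using S xs genideal_self[of S] idS
    by (auto simp: A_def additive_subgroup.zero_closed ideal.axioms(1) subset_iff)
  have d_in: "D 0 0 \<in> Idl S"
    unfolding D_def by (intro fun_mult_ideal_left[OF idS] fun_mult_ideal_right[OF idS] A_in c)
  define J where "J = PIdl (D 0 0)"
  have idJ: "ideal J R"
    unfolding J_def by (intro cgenideal_ideal over_carrierD D)
  have D_in: "D 0 j \<in> J" if "j < n" for j
    using zero[OF that] idJ cgenideal_self[OF over_carrierD[OF D, of 0 0]]
    by (cases "j = 0") (auto simp: J_def additive_subgroup.zero_closed ideal.axioms(1))
  have "A 0 j \<in> J" if j: "j < n" for j
  proof -
    \<comment> \<open>In the columns below \<open>n\<close>, \<open>D Q'\<close> agrees with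
      \<open>P A\<close>, and a further factor \<open>P'\<close> recovers row 0 of
      \<open>A\<close>.\<close>
    have "fun_mult n D Q' = fun_mult 1 P (fun_mult n A (fun_mult n Q Q'))"
      unfolding D_def by (simp add: fun_mult_assoc A c over_carrier_fun_mult)
    moreover have "fun_mult n A (fun_mult n Q Q') r j = A r j" for r
      using Q(1) j fun_mult_cong[of n A r A "fun_mult n Q Q'" j fun_one] fun_mult_fun_one_right[OF A j] A over_carrier_fun_one
      by (simp add: inv_pair_def)
    ultimately have "fun_mult 1 P' (fun_mult n D Q') 0 j = fun_mult 1 P' (fun_mult 1 P A) 0 j"
      using fun_mult_cong[of 1 P' 0 P' "fun_mult n D Q'" j "fun_mult 1 P A"] fun_mult_cong[of 1 P _ P "fun_mult n A (fun_mult n Q Q')" j A]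
        A c over_carrier_fun_mult by simp
    also have "\<dots> = fun_mult 1 (fun_mult 1 P' P) A 0 j"
      by (simp add: fun_mult_assoc A c)
    also have "\<dots> = fun_mult 1 fun_one A 0 j"
      using P(1) by (intro fun_mult_cong) (auto simp: inv_pair_def A over_carrier_fun_one)
    also have "\<dots> = A 0 j"
      by (rule fun_mult_fun_one_left) (auto simp: A)
    finally have "A 0 j = fun_mult 1 P' (fun_mult n D Q') 0 j" ..
    also have "\<dots> \<in> J"
      by (intro fun_mult_ideal_right[OF idJ _ c(2)] fun_mult_ideal_left[OF idJ _ c(4)]) (use D_in in auto)
    finally show ?thesis .
  qed
  then have "S \<subseteq> J"
    unfolding xs[symmetric] by (auto simp: in_set_conv_nth A_def n_def) (metis less_SucI)
  then have "Idl S \<subseteq> J"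
    by (intro genideal_minimal idJ)
  moreover have "J \<subseteq> Idl S"
    unfolding J_def by (intro cgenideal_minimal idS d_in)
  ultimately have "Idl S = Idl {D 0 0}"
    using cgenideal_eq_genideal[OF over_carrierD[OF D]] by (simp add: J_def)
  then show "principalideal (Idl S) R"
    by (intro principalidealI idS) (use D over_carrierD in blast)
qed

end

theorem theorem2p9:
  fixes R (structure)
  assumes "cring R"
    and "locally_stable R"
  shows "elementary_divisor_ring R \<longleftrightarrow> bezout_ring R"
  using cring.elementary_divisor_imp_bezout[OF assms(1)]
    cring.bezout_imp_elementary_divisor[OF assms(1) _ assms(2)] by blast

end
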